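(* Let $n\ge1$ be an integer, $0\leq\theta\leq 1$ and $s\in\mathbb{R}$. There exists a constant $C=C_n>0$ such that $$\Vert\partial_t\Lambda_\theta(t)g\Vert_{H^{s-1}(\mathbb{R}^n)}\leq C\,\Vert g\Vert_{H^{s-1}(\mathbb{R}^n)}$$ for all $g\in\mathscr{S}(\mathbb{R}^n)$ and $t>0$.
   Context: For $t\geq 0$, $S(t)$ is the Fourier multiplier operator on $\mathbb{R}^n$ with symbol $$m(\xi,t)=e^{-\frac{|\xi|^2t}{2(1+|\xi|^2)}}\,\frac{2(1+|\xi|^2)}{|\xi|^2\sqrt{3+4|\xi|^2}}\,\sin\left(\frac{|\xi|^2\sqrt{3+4|\xi|^2}\,t}{2(1+|\xi|^2)}\right)$$ (equal to $t$ at $\xi=0$), $\Lambda_\theta(t)=S(t)(I-\Delta)^{-1}(-\Delta)^\theta$ is the Fourier multiplier operator with symbol $m(\xi,t)(1+|\xi|^2)^{-1}|\xi|^{2\theta}$, and $\partial_t\Lambda_\theta(t)$ is the one with symbol $\partial_tm(\xi,t)(1+|\xi|^2)^{-1}|\xi|^{2\theta}$. $\mathscr{S}(\mathbb{R}^n)$ is the Schwartz space and $H^s(\mathbb{R}^n)$ the $L^2$-based Sobolev space. $C_n$ denotes a constant depending only on $n$. *)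

theory Defs
  imports "HOL-Analysis.Analysis"
begin

subsection \<open>Schwartz functions and tempered distributions\<close>

definition partial_deriv :: "'n::finite \<Rightarrow> (real^'n \<Rightarrow> complex) \<Rightarrow> real^'n \<Rightarrow> complex" where
  "partial_deriv i f = (\<lambda>x. frechet_derivative f (at x) (axis i 1))"

text \<open>Multi-indices are represented by lists of coordinate indices; for smooth functions the
  order of the entries is irrelevant.\<close>

definition partial_derivs :: "'n::finite list \<Rightarrow> (real^'n \<Rightarrow> complex) \<Rightarrow> real^'n \<Rightarrow> complex" where
  "partial_derivs is f = foldr partial_deriv is f"

definition schwartz :: "(real^'n::finite \<Rightarrow> complex) \<Rightarrow> bool" where
  "schwartz f \<longleftrightarrow>
     (\<forall>is. partial_derivs is f differentiable_on UNIV) \<and>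
     (\<forall>is k. \<exists>B. \<forall>x. norm x ^ k * norm (partial_derivs is f x) \<le> B)"

text \<open>Distributions are functionals of which only the values on Schwartz functions matter.
  The last clause is continuity, that is, boundedness by finitely many Schwartz seminorms:
  \<open>B\<close> ranges over the common upper bounds of the seminorms of order at most \<open>N\<close>.\<close>

definition tempered_distribution :: "((real^'n::finite \<Rightarrow> complex) \<Rightarrow> complex) \<Rightarrow> bool" where
  "tempered_distribution T \<longleftrightarrow>
     (\<forall>\<phi> \<psi>. schwartz \<phi> \<longrightarrow> schwartz \<psi> \<longrightarrow> T (\<lambda>x. \<phi> x + \<psi> x) = T \<phi> + T \<psi>) \<and>
     (\<forall>c \<phi>. schwartz \<phi> \<longrightarrow> T (\<lambda>x. c * \<phi> x) = c * T \<phi>) \<and>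
     (\<exists>K N. \<forall>\<phi> B. schwartz \<phi> \<longrightarrow>
        (\<forall>k is x. k \<le> N \<longrightarrow> length is \<le> N \<longrightarrow> norm x ^ k * norm (partial_derivs is \<phi> x) \<le> B) \<longrightarrow>
        norm (T \<phi>) \<le> K * B)"

definition distribution_of :: "(real^'n::finite \<Rightarrow> complex) \<Rightarrow> (real^'n \<Rightarrow> complex) \<Rightarrow> complex" where
  "distribution_of f \<phi> = (LINT x|lborel. f x * \<phi> x)"


subsection \<open>Fourier transform, multipliers and Sobolev norms\<close>

text \<open>The frequency variable is normalised so that \<open>-\<Delta>\<close> has symbol \<open>|\<xi>|\<^sup>2\<close>.\<close>

definition fourier :: "(real^'n::finite \<Rightarrow> complex) \<Rightarrow> real^'n \<Rightarrow> complex" where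
  "fourier f \<xi> = (LINT x|lborel. cis (- (x \<bullet> \<xi>)) * f x)"

definition inverse_fourier :: "(real^'n::finite \<Rightarrow> complex) \<Rightarrow> real^'n \<Rightarrow> complex" where
  "inverse_fourier h x = (LINT \<xi>|lborel. cis (x \<bullet> \<xi>) * h \<xi>) / (2 * pi) ^ CARD('n)"

definition fourier_multiplier ::
    "(real^'n::finite \<Rightarrow> complex) \<Rightarrow> (real^'n \<Rightarrow> complex) \<Rightarrow> real^'n \<Rightarrow> complex" where
  "fourier_multiplier \<sigma> g = inverse_fourier (\<lambda>\<xi>. \<sigma> \<xi> * fourier g \<xi>)"

text \<open>\<open>T\<close> belongs to \<open>H\<^sup>s\<close> with Fourier transform \<open>F\<close>. The Fourier transform of a tempered
  distribution is defined by duality, \<open>\<phi> \<mapsto> T (fourier \<phi>)\<close>.\<close>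

definition sobolev_transform ::
    "real \<Rightarrow> ((real^'n::finite \<Rightarrow> complex) \<Rightarrow> complex) \<Rightarrow> (real^'n \<Rightarrow> complex) \<Rightarrow> bool" where
  "sobolev_transform s T F \<longleftrightarrow>
     tempered_distribution T \<and>
     F \<in> borel_measurable lborel \<and>
     integrable lborel (\<lambda>\<xi>. (1 + (norm \<xi>)\<^sup>2) powr s * (norm (F \<xi>))\<^sup>2) \<and>
     (\<forall>\<phi>. schwartz \<phi> \<longrightarrow> T (fourier \<phi>) = (LINT \<xi>|lborel. F \<xi> * \<phi> \<xi>))"

text \<open>The function \<open>F\<close> is unique up to null sets, so the infimum is over at most one value;
  it is \<open>\<infinity>\<close> precisely when \<open>T\<close> is not in \<open>H\<^sup>s\<close>.\<close>

definition sobolev_norm :: "real \<Rightarrow> ((real^'n::finite \<Rightarrow> complex) \<Rightarrow> complex) \<Rightarrow> ennreal" where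
  "sobolev_norm s T =
     (INF F\<in>{F. sobolev_transform s T F}.
        ennreal (sqrt (LINT \<xi>|lborel. (1 + (norm \<xi>)\<^sup>2) powr s * (norm (F \<xi>))\<^sup>2)))"


subsection \<open>The operators\<close>

definition symbol_S :: "real^'n::finite \<Rightarrow> real \<Rightarrow> real" where
  "symbol_S \<xi> t =
     (if \<xi> = 0 then t
      else exp (- ((norm \<xi>)\<^sup>2 * t / (2 * (1 + (norm \<xi>)\<^sup>2))))
        * (2 * (1 + (norm \<xi>)\<^sup>2) / ((norm \<xi>)\<^sup>2 * sqrt (3 + 4 * (norm \<xi>)\<^sup>2)))
        * sin ((norm \<xi>)\<^sup>2 * sqrt (3 + 4 * (norm \<xi>)\<^sup>2) * t / (2 * (1 + (norm \<xi>)\<^sup>2))))"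

text \<open>The symbol \<open>|\<xi>|\<close> to the power \<open>2\<theta>\<close> of \<open>(-\<Delta>)\<close> to the power \<open>\<theta>\<close>. The case distinction is needed
  because \<open>0 powr 0 = 0\<close>.\<close>

definition symbol_laplacian_power :: "real \<Rightarrow> real^'n::finite \<Rightarrow> real" where
  "symbol_laplacian_power \<theta> \<xi> = (if \<theta> = 0 then 1 else norm \<xi> powr (2 * \<theta>))"

definition Lambda :: "real \<Rightarrow> real \<Rightarrow> (real^'n::finite \<Rightarrow> complex) \<Rightarrow> real^'n \<Rightarrow> complex" where
  "Lambda \<theta> t = fourier_multiplier (\<lambda>\<xi>. complex_of_real
     (symbol_S \<xi> t * inverse (1 + (norm \<xi>)\<^sup>2) * symbol_laplacian_power \<theta> \<xi>))"

definition dt_Lambda :: "real \<Rightarrow> real \<Rightarrow> (real^'n::finite \<Rightarrow> complex) \<Rightarrow> real^'n \<Rightarrow> complex" where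
  "dt_Lambda \<theta> t = fourier_multiplier (\<lambda>\<xi>. complex_of_real
     (deriv (\<lambda>\<tau>. symbol_S \<xi> \<tau>) t * inverse (1 + (norm \<xi>)\<^sup>2) * symbol_laplacian_power \<theta> \<xi>))"

end

theory Submission
  imports Defs "HOL-Probability.Characteristic_Functions" "HOL-Probability.Sinc_Integral"
begin

text \<open>The symbol of \<open>dt_Lambda\<close> is bounded by 2: differentiation in time cancels the singular factor of
  \<open>symbol_S\<close>, leaving a damped \<open>cos - sin / sqrt (3 + 4|\<xi>|\<^sup>2)\<close>, and \<open>|\<xi>|\<close> to the power \<open>2\<theta>\<close> is at most
  \<open>1 + |\<xi>|\<^sup>2\<close>. What remains is the bound for a multiplier \<open>\<sigma>\<close> with \<open>|\<sigma>| \<le> C\<close> on the Sobolev norms as defined.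
  Fourier inversion shows that \<open>\<sigma> * fourier g\<close> is a transform of the image of \<open>g\<close>. If \<open>F\<close> is any transform
  of \<open>g\<close>, then \<open>F\<close> and \<open>fourier g\<close> have the same Gaussian mollifications; convolution with a narrow
  Gaussian is almost a contraction on the weighted \<open>L\<^sup>2\<close> space, so Fatou's lemma bounds the weighted norm of
  \<open>fourier g\<close> by that of \<open>F\<close>. If \<open>g\<close> has no transform, the right-hand side is infinite.\<close>

subsection \<open>Integration over Euclidean space\<close>

text \<open>The obstacle lies in \<open>sobolev_norm\<close>: it is an infimum over every
  \<open>F\<close> that represents the transform, and of such an \<open>F\<close> only
  measurability, a finite weighted integral and the pairings with Schwartz functions are given.
  Comparing \<open>F\<close> with \<open>fourier g\<close> calls for test functions that are
  Schwartz and form an approximate identity. Gaussians are both, and their explicit transforms also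
  drive the inversion theorem. The constant in the result may not depend on \<open>s\<close>.
  Mollifying at a fixed width costs a factor depending on \<open>s\<close>, through the growth of
  the weight; letting the width shrink sends this factor to 1.\<close>

lemma nn_integral_lborel_affine:
  fixes t :: "'a::euclidean_space"
  assumes [measurable]: "f \<in> borel_measurable borel" and c: "c \<noteq> 0"
  shows "(\<integral>\<^sup>+x. f x \<partial>lborel) = ennreal (\<bar>c\<bar> ^ DIM('a)) * (\<integral>\<^sup>+x. f (t + c *\<^sub>R x) \<partial>lborel)"
  by (subst lborel_affine[OF c, of t])
     (simp add: nn_integral_density nn_integral_distr nn_integral_cmult)

lemma integrable_lborel_affine:
  fixes f :: "'a::euclidean_space \<Rightarrow> 'b::{banach, second_countable_topology}"
  assumes f: "integrable lborel f" and c: "c \<noteq> 0"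
  shows "integrable lborel (\<lambda>x. f (t + c *\<^sub>R x))"
proof -
  have [measurable]: "f \<in> borel_measurable borel"
    using borel_measurable_integrable[OF f] by simp
  show ?thesis
    using f c unfolding integrable_iff_bounded
    by (subst (asm) nn_integral_lborel_affine[where c=c and t=t])
       (auto simp: ennreal_mult_less_top)
qed

lemma integral_lborel_affine:
  fixes f :: "'a::euclidean_space \<Rightarrow> 'b::{banach, second_countable_topology}"
  assumes f: "integrable lborel f" and c: "c \<noteq> 0"
  shows "(\<integral>x. f x \<partial>lborel) = (\<bar>c\<bar> ^ DIM('a)) *\<^sub>R (\<integral>x. f (t + c *\<^sub>R x) \<partial>lborel)"
proof -
  have [measurable]: "f \<in> borel_measurable borel"
    using borel_measurable_integrable[OF f] by simp
  show ?thesis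
    using c f integrable_lborel_affine[OF f c, of t]
    by (subst lborel_affine[OF c, of t]) (simp add: integral_density integral_distr)
qed

text \<open>Lebesgue measure is the image of the product of the one-dimensional Lebesgue measures
  under \<open>x \<mapsto> (\<Sum>i\<in>Basis. x i *\<^sub>R i)\<close>, so the rule for tensor
  products on product spaces carries over.\<close>

lemma
  fixes f :: "'a::euclidean_space \<Rightarrow> real \<Rightarrow> 'b::{real_normed_field, banach, second_countable_topology}"
  assumes f: "\<And>b. b \<in> Basis \<Longrightarrow> integrable lborel (f b)"
  shows integrable_lborel_prod_Basis: "integrable lborel (\<lambda>x::'a. \<Prod>b\<in>Basis. f b (x \<bullet> b))"
    and integral_lborel_prod_Basis:
      "(\<integral>x. (\<Prod>b\<in>(Basis::'a set). f b (x \<bullet> b)) \<partial>lborel) = (\<Prod>b\<in>Basis. \<integral>x. f b x \<partial>lborel)"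
proof -
  interpret product_sigma_finite "\<lambda>_::'a. lborel :: real measure" ..
  have [measurable]: "\<And>b. b \<in> Basis \<Longrightarrow> f b \<in> borel_measurable borel"
    using borel_measurable_integrable[OF f] by simp
  have eq: "(\<Prod>b\<in>Basis. f b ((\<Sum>i\<in>Basis. x i *\<^sub>R i) \<bullet> b)) = (\<Prod>b\<in>Basis. f b (x b))" for x :: "'a \<Rightarrow> real"
    by (intro prod.cong) auto
  have 1: "integrable (\<Pi>\<^sub>M b\<in>Basis. lborel) (\<lambda>x. \<Prod>b\<in>(Basis::'a set). f b (x b))"
    by (intro product_integrable_prod f) auto
  show "integrable lborel (\<lambda>x::'a. \<Prod>b\<in>Basis. f b (x \<bullet> b))"
    by (subst lborel_eq, subst integrable_distr_eq) (auto simp: eq 1)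
  show "(\<integral>x. (\<Prod>b\<in>(Basis::'a set). f b (x \<bullet> b)) \<partial>lborel) = (\<Prod>b\<in>Basis. \<integral>x. f b x \<partial>lborel)"
    by (subst lborel_eq, subst integral_distr)
       (auto simp: eq product_integral_prod f)
qed

lemma measurable_cis [measurable]: "cis \<in> borel_measurable borel"
  by (intro borel_measurable_continuous_onI continuous_intros)

lemma prod_one_plus_le_norm_power:
  fixes x :: "'a::euclidean_space"
  shows "(\<Prod>b\<in>Basis. 1 + (x \<bullet> b)\<^sup>2) \<le> (1 + norm x) ^ (2 * DIM('a))"
proof -
  have "(\<Prod>b\<in>Basis. 1 + (x \<bullet> b)\<^sup>2) \<le> (\<Prod>b\<in>(Basis::'a set). (1 + norm x)\<^sup>2)"
  proof (intro prod_mono conjI)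
    fix b :: 'a assume b: "b \<in> Basis"
    have "(x \<bullet> b)\<^sup>2 \<le> (norm x)\<^sup>2"
      using Basis_le_norm[OF b, of x] by (simp add: abs_le_square_iff[symmetric])
    then show "1 + (x \<bullet> b)\<^sup>2 \<le> (1 + norm x)\<^sup>2"
      by (simp add: power2_sum add_increasing2)
  qed auto
  then show ?thesis by (simp add: power_mult)
qed

text \<open>The comparison function is the tensor product of the integrable functions
  \<open>1 / (1 + s\<^sup>2)\<close>. Each of its \<open>DIM('a)\<close> factors costs
  \<open>(1 + norm x)\<^sup>2\<close>, whence the exponent \<open>2 * DIM('a)\<close> used for decay
  throughout.\<close>

lemma integrable_inverse_one_plus_norm:
  "integrable lborel (\<lambda>x::'a::euclidean_space. inverse ((1 + norm x) ^ (2 * DIM('a))))"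
proof (rule Bochner_Integration.integrable_bound)
  have "integrable lborel (\<lambda>x::real. inverse (1 + x\<^sup>2))"
    using integrable_inverse_1_plus_square by (simp add: set_integrable_def einterval_def)
  then show "integrable lborel (\<lambda>x::'a. \<Prod>b\<in>Basis. inverse (1 + (x \<bullet> b)\<^sup>2))"
    by (rule integrable_lborel_prod_Basis)
  show "AE x in lborel. norm (inverse ((1 + norm x) ^ (2 * DIM('a)))) \<le> norm (\<Prod>b\<in>(Basis::'a set). inverse (1 + (x \<bullet> b)\<^sup>2))"
  proof (rule AE_I2)
    fix x :: 'a
    have "inverse ((1 + norm x) ^ (2 * DIM('a))) \<le> inverse (\<Prod>b\<in>Basis. 1 + (x \<bullet> b)\<^sup>2)"
      by (intro le_imp_inverse_le prod_one_plus_le_norm_power prod_pos) (auto simp: add_pos_nonneg)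
    then show "norm (inverse ((1 + norm x) ^ (2 * DIM('a)))) \<le> norm (\<Prod>b\<in>(Basis::'a set). inverse (1 + (x \<bullet> b)\<^sup>2))"
      by (simp add: prod_inversef[symmetric] o_def abs_prod)
  qed
qed simp

lemma integrable_of_decay:
  fixes f :: "'a::euclidean_space \<Rightarrow> 'b::{banach, second_countable_topology}"
  assumes [measurable]: "f \<in> borel_measurable borel"
    and B: "\<And>x. (1 + norm x) ^ (2 * DIM('a)) * norm (f x) \<le> B"
  shows "integrable lborel f"
proof (rule Bochner_Integration.integrable_bound)
  show "integrable lborel (\<lambda>x::'a. B * inverse ((1 + norm x) ^ (2 * DIM('a))))"
    by (intro integrable_mult_right integrable_inverse_one_plus_norm)
  show "AE x in lborel. norm (f x) \<le> norm (B * inverse ((1 + norm x) ^ (2 * DIM('a))))"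
  proof (rule AE_I2)
    fix x :: 'a
    have p: "(1 + norm x) ^ (2 * DIM('a)) > 0" by (simp add: add_pos_nonneg)
    then have "norm (f x) \<le> B * inverse ((1 + norm x) ^ (2 * DIM('a)))"
      using B[of x] by (simp add: field_simps)
    then show "norm (f x) \<le> norm (B * inverse ((1 + norm x) ^ (2 * DIM('a))))"
      by (auto simp del: power_mult)
  qed
qed simp

subsection \<open>Gaussians\<close>

definition gauss :: "'a::euclidean_space \<Rightarrow> real" where
  "gauss x = exp (- (norm x)\<^sup>2 / 2)"

lemma gauss_nonneg: "gauss x \<ge> 0" and gauss_le_1: "gauss x \<le> 1"
  and gauss_0 [simp]: "gauss 0 = 1" and gauss_minus [simp]: "gauss (- x) = gauss x"
  by (auto simp: gauss_def)

lemma measurable_gauss [measurable]: "gauss \<in> borel_measurable borel"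
  unfolding gauss_def by measurable

lemma polynomial_mult_exp_square_bounded:
  assumes "c > 0"
  shows "\<exists>B. \<forall>r\<ge>0. (1 + r) ^ k * exp (- (c * r\<^sup>2)) \<le> (B::real)"
proof -
  have "((\<lambda>r. (1 + r) ^ k * exp (- (c * r\<^sup>2))) \<longlongrightarrow> 0) at_top"
    using assms by real_asymp
  then obtain R where R: "\<And>r. r \<ge> R \<Longrightarrow> (1 + r) ^ k * exp (- (c * r\<^sup>2)) < 1"
    using order_tendstoD(2)[of "\<lambda>r. (1 + r) ^ k * exp (- (c * r\<^sup>2))" 0 at_top 1]
    by (auto simp: eventually_at_top_linorder)
  have "continuous_on {0..max 0 R} (\<lambda>r. (1 + r) ^ k * exp (- (c * r\<^sup>2)))"
    by (intro continuous_intros)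
  then obtain m where m: "\<And>r. r \<in> {0..max 0 R} \<Longrightarrow> (1 + r) ^ k * exp (- (c * r\<^sup>2)) \<le> m"
    using compact_continuous_image[of "{0..max 0 R}"] compact_imp_bounded bounded_has_Sup
    by (metis (no_types, lifting) bdd_above.E bounded_imp_bdd_above compact_Icc image_eqI)
  show ?thesis
  proof (intro exI[of _ "max m 1"] allI impI)
    fix r :: real assume "r \<ge> 0"
    then show "(1 + r) ^ k * exp (- (c * r\<^sup>2)) \<le> max m 1"
      using m[of r] R[of r] by (cases "r \<le> max 0 R") (auto simp: less_imp_le)
  qed
qed

lemma integrable_power_gauss:
  "integrable lborel (\<lambda>x::'a::euclidean_space. (1 + norm x) ^ k * gauss x)"
proof -
  obtain B where B: "\<And>r. r \<ge> 0 \<Longrightarrow> (1 + r) ^ (2 * DIM('a) + k) * exp (- (1/2 * r\<^sup>2)) \<le> (B::real)"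
    using polynomial_mult_exp_square_bounded[of "1/2"] by force
  show ?thesis
  proof (rule integrable_of_decay)
    show "(1 + norm x) ^ (2 * DIM('a)) * norm ((1 + norm x) ^ k * gauss x) \<le> B" for x :: 'a
      using B[of "norm x"] by (simp add: gauss_def power_add abs_mult mult.assoc)
  qed measurable
qed

lemma integrable_gauss: "integrable lborel (gauss :: 'a::euclidean_space \<Rightarrow> real)"
  using integrable_power_gauss[of 0] by simp

text \<open>Up to the normalisation \<open>sqrt (2 * pi)\<close>, this is the characteristic
  function of the standard normal distribution.\<close>

lemma integral_cis_gauss_real:
  "integrable lborel (\<lambda>x::real. cis (x * t) * of_real (exp (- x\<^sup>2 / 2)))"
  "(\<integral>x. cis (x * t) * of_real (exp (- x\<^sup>2 / 2)) \<partial>lborel) = complex_of_real (sqrt (2 * pi) * exp (- t\<^sup>2 / 2))"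
proof -
  show "integrable lborel (\<lambda>x::real. cis (x * t) * of_real (exp (- x\<^sup>2 / 2)))"
    by (rule Bochner_Integration.integrable_bound[OF integrable_gauss[where 'a=real]])
       (auto simp: gauss_def norm_mult)
  have "(\<integral>x. cis (x * t) * of_real (exp (- x\<^sup>2 / 2)) \<partial>lborel)
      = (\<integral>x. complex_of_real (sqrt (2 * pi)) * (std_normal_density x *\<^sub>R cis (x * t)) \<partial>lborel)"
    by (intro Bochner_Integration.integral_cong)
       (auto simp: std_normal_density_def scaleR_conv_of_real field_simps simp del: real_sqrt_mult)
  also have "\<dots> = complex_of_real (sqrt (2 * pi)) * (\<integral>x. std_normal_density x *\<^sub>R cis (x * t) \<partial>lborel)"
    by (rule integral_mult_right_zero)
  also have "(\<integral>x. std_normal_density x *\<^sub>R cis (x * t) \<partial>lborel) = char std_normal_distribution t"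
    unfolding char_def by (subst integral_density) (auto simp: cis_conv_exp mult.commute)
  finally show "(\<integral>x. cis (x * t) * of_real (exp (- x\<^sup>2 / 2)) \<partial>lborel) = complex_of_real (sqrt (2 * pi) * exp (- t\<^sup>2 / 2))"
    by (simp add: char_std_normal_distribution)
qed

lemma cis_sum: "finite A \<Longrightarrow> cis (sum f A) = (\<Prod>a\<in>A. cis (f a))"
  by (induction A rule: finite_induct) (auto simp: cis_mult[symmetric])

text \<open>Both the character and the Gaussian are tensor products over the basis, which reduces
  the claim to the real line.\<close>

lemma integral_cis_gauss:
  fixes \<xi> :: "'a::euclidean_space"
  shows "(\<integral>x. cis (x \<bullet> \<xi>) * of_real (gauss x) \<partial>lborel) = complex_of_real (sqrt (2 * pi) ^ DIM('a) * gauss \<xi>)"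
proof -
  have g: "gauss x = (\<Prod>b\<in>Basis. exp (- (x \<bullet> b)\<^sup>2 / 2))" for x :: 'a
    by (simp add: gauss_def exp_sum[symmetric] sum_divide_distrib[symmetric] sum_negf
        euclidean_inner[of x x] power2_norm_eq_inner) (simp add: power2_eq_square)
  have "(\<integral>x. cis (x \<bullet> \<xi>) * of_real (gauss x) \<partial>lborel)
     = (\<integral>x. (\<Prod>b\<in>Basis. cis ((x \<bullet> b) * (\<xi> \<bullet> b)) * complex_of_real (exp (- (x \<bullet> b)\<^sup>2 / 2))) \<partial>lborel)"
    by (intro Bochner_Integration.integral_cong refl)
       (simp add: prod.distrib cis_sum euclidean_inner[of _ \<xi>] g)
  also have "\<dots> = (\<Prod>b\<in>(Basis::'a set). complex_of_real (sqrt (2 * pi) * exp (- (\<xi> \<bullet> b)\<^sup>2 / 2)))"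
    by (subst integral_lborel_prod_Basis[of "\<lambda>b s. cis (s * (\<xi> \<bullet> b)) * complex_of_real (exp (- s\<^sup>2 / 2))"])
       (auto intro!: prod.cong simp del: of_real_mult minus_divide_left simp: integral_cis_gauss_real[simplified] integral_cis_gauss_real)
  also have "\<dots> = complex_of_real (sqrt (2 * pi) ^ DIM('a) * gauss \<xi>)"
    by (simp add: g prod.distrib)
  finally show ?thesis .
qed

lemma integral_gauss: "(\<integral>x. gauss (x::'a) \<partial>lborel) = sqrt (2 * pi) ^ DIM('a::euclidean_space)"
proof -
  have "complex_of_real (\<integral>x. gauss (x::'a) \<partial>lborel) = complex_of_real (sqrt (2 * pi) ^ DIM('a))"
    using integral_cis_gauss[of "0::'a"] by simp
  then show ?thesis by (simp only: of_real_eq_iff)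
qed

subsection \<open>Fourier inversion\<close>

text \<open>\<open>foldr\<close> applies the last entry of the list first, so a derivative taken
  beforehand is appended at the end. Closure of the Schwartz class under
  \<open>partial_deriv\<close> follows by instantiating its definition at the longer list.\<close>

lemma partial_derivs_snoc: "partial_derivs is (partial_deriv i f) = partial_derivs (is @ [i]) f"
  by (simp add: partial_derivs_def)

lemma schwartz_partial_deriv: "schwartz f \<Longrightarrow> schwartz (partial_deriv i f)"
  by (simp add: schwartz_def partial_derivs_snoc)

lemma schwartz_differentiable:
  assumes "schwartz f" shows "f differentiable (at x)"
proof -
  have "partial_derivs [] f differentiable_on UNIV"
    using assms unfolding schwartz_def by blast
  then show ?thesis by (simp add: partial_derivs_def differentiable_on_def)
qed

section \<open>Regularity, decay and integrability of Schwartz functions\<close>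

lemma schwartz_continuous: "schwartz f \<Longrightarrow> continuous_on A f"
  by (meson continuous_at_imp_continuous_on differentiable_imp_continuous_within schwartz_differentiable)

lemma schwartz_measurable: "schwartz f \<Longrightarrow> f \<in> borel_measurable borel"
  by (intro borel_measurable_continuous_onI schwartz_continuous)

lemma one_plus_power_le:
  fixes r :: real
  assumes "r \<ge> 0" shows "(1 + r) ^ k \<le> 2 ^ k * (1 + r ^ k)"
proof -
  have "(1 + r) ^ k \<le> (2 * max 1 r) ^ k"
    using assms by (intro power_mono) auto
  also have "\<dots> \<le> 2 ^ k * (1 + r ^ k)"
    using assms by (auto simp: power_mult_distrib max_def)
  finally show ?thesis .
qed

lemma schwartz_decay:
  assumes "schwartz f"
  obtains B where "\<And>x. (1 + norm x) ^ k * norm (f x) \<le> B"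
proof -
  have *: "\<exists>B. \<forall>x. norm x ^ j * norm (partial_derivs [] f x) \<le> B" for j
    using assms unfolding schwartz_def by blast
  obtain B0 where B0: "\<And>x. norm x ^ 0 * norm (f x) \<le> B0"
    using *[of 0] by (auto simp: partial_derivs_def)
  obtain B1 where B1: "\<And>x. norm x ^ k * norm (f x) \<le> B1"
    using *[of k] by (auto simp: partial_derivs_def)
  have "(1 + norm x) ^ k * norm (f x) \<le> 2 ^ k * (B0 + B1)" for x
  proof -
    have "(1 + norm x) ^ k * norm (f x) \<le> (2 ^ k * (1 + norm x ^ k)) * norm (f x)"
      by (intro mult_right_mono one_plus_power_le) auto
    also have "\<dots> = 2 ^ k * (norm x ^ 0 * norm (f x) + norm x ^ k * norm (f x))"
      by (simp add: algebra_simps)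
    also have "\<dots> \<le> 2 ^ k * (B0 + B1)"
      by (intro mult_left_mono add_mono B0 B1) auto
    finally show ?thesis .
  qed
  then show ?thesis by (rule that)
qed

lemma schwartz_integrable: "schwartz f \<Longrightarrow> integrable lborel f"
  by (rule schwartz_decay[of f "2 * DIM((real, 'a) vec)"])
     (auto intro!: integrable_of_decay schwartz_measurable)

lemma schwartz_bounded:
  assumes "schwartz f"
  obtains B where "\<And>x. norm (f x) \<le> B"
  using schwartz_decay[OF assms, of 0] by auto

section \<open>Integrals against a unimodular kernel\<close>

lemma integrable_cis_mult:
  fixes f :: "'a::euclidean_space \<Rightarrow> complex"
  assumes "integrable lborel f" and [measurable]: "r \<in> borel_measurable borel"
  shows "integrable lborel (\<lambda>x. cis (r x) * f x)"
proof (rule Bochner_Integration.integrable_bound[OF assms(1)])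
  show "(\<lambda>x. cis (r x) * f x) \<in> borel_measurable lborel"
    using borel_measurable_integrable[OF assms(1)] by measurable
qed (auto simp: norm_mult)

text \<open>The factor \<open>c\<close> lets one statement serve both transforms:
  \<open>c = -1\<close> gives \<open>fourier\<close>, \<open>c = 1\<close> gives
  \<open>inverse_fourier\<close> up to its constant.\<close>

lemma continuous_integral_cis:
  fixes f :: "'a::euclidean_space \<Rightarrow> complex"
  assumes f: "integrable lborel f"
  shows "continuous_on UNIV (\<lambda>y. LINT x|lborel. cis (c * (x \<bullet> y)) * f x)"
proof (rule continuous_on_sequentiallyI)
  fix u :: "nat \<Rightarrow> 'a" and a assume u: "u \<longlonglongrightarrow> a"
  have [measurable]: "f \<in> borel_measurable borel"
    using borel_measurable_integrable[OF f] by simp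
  show "(\<lambda>k. LINT x|lborel. cis (c * (x \<bullet> u k)) * f x) \<longlonglongrightarrow> (LINT x|lborel. cis (c * (x \<bullet> a)) * f x)"
  proof (rule integral_dominated_convergence[where w="\<lambda>x. norm (f x)"])
    have "isCont cis z" for z
      using continuous_on_cis[OF continuous_on_id, of UNIV] by (simp add: continuous_on_eq_continuous_at)
    then show "AE x in lborel. (\<lambda>k. cis (c * (x \<bullet> u k)) * f x) \<longlonglongrightarrow> cis (c * (x \<bullet> a)) * f x"
      by (intro AE_I2 tendsto_intros isCont_tendsto_compose[of _ cis] u)
  qed (use f in \<open>auto simp: norm_mult\<close>)
qed

text \<open>Fubini applies because the integrand has modulus \<open>norm (f x) * norm (g y)\<close>.
  This is the multiplication formula for both transforms at once.\<close>

lemma integral_cis_mult_swap: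
  fixes f g :: "'a::euclidean_space \<Rightarrow> complex"
  assumes f: "integrable lborel f" and g: "integrable lborel g"
  shows "(LINT y|lborel. (LINT x|lborel. cis (c * (x \<bullet> y)) * f x) * g y)
       = (LINT x|lborel. f x * (LINT y|lborel. cis (c * (y \<bullet> x)) * g y))"
proof -
  have [measurable]: "f \<in> borel_measurable borel" "g \<in> borel_measurable borel"
    using borel_measurable_integrable[OF f] borel_measurable_integrable[OF g] by simp_all
  have "integrable (lborel \<Otimes>\<^sub>M lborel) (\<lambda>(x, y). cis (c * (x \<bullet> y)) * f x * g y)"
  proof (rule lborel_pair.Fubini_integrable)
    show "integrable lborel (\<lambda>x. LINT y|lborel. norm (case (x, y) of (x, y) \<Rightarrow> cis (c * (x \<bullet> y)) * f x * g y))"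
      using f by (simp add: norm_mult)
    show "AE x in lborel. integrable lborel (\<lambda>y. case (x, y) of (x, y) \<Rightarrow> cis (c * (x \<bullet> y)) * f x * g y)"
    proof (rule AE_I2)
      fix x :: 'a
      have "integrable lborel (\<lambda>y. f x * (cis (c * (x \<bullet> y)) * g y))"
        by (intro integrable_mult_right integrable_cis_mult g) simp
      then show "integrable lborel (\<lambda>y. case (x, y) of (x, y) \<Rightarrow> cis (c * (x \<bullet> y)) * f x * g y)"
        by (simp add: mult_ac)
    qed
  qed measurable
  then have "(LINT y|lborel. LINT x|lborel. cis (c * (x \<bullet> y)) * f x * g y)
       = (LINT x|lborel. LINT y|lborel. cis (c * (x \<bullet> y)) * f x * g y)"
    by (rule lborel_pair.Fubini_integral)
  also have "\<dots> = (LINT x|lborel. LINT y|lborel. f x * (cis (c * (y \<bullet> x)) * g y))"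
    by (simp add: mult_ac inner_commute)
  finally show ?thesis by simp
qed

lemma fourier_eq: "fourier f \<xi> = (LINT x|lborel. cis (-1 * (x \<bullet> \<xi>)) * f x)"
  by (simp add: fourier_def)

lemma inverse_fourier_eq:
  "inverse_fourier f x = (LINT \<xi>|lborel. cis (1 * (\<xi> \<bullet> x)) * f \<xi>) / (2 * pi) ^ CARD('n)"
  for f :: "real^'n::finite \<Rightarrow> complex"
  by (simp add: inverse_fourier_def inner_commute)

lemma continuous_fourier: "integrable lborel f \<Longrightarrow> continuous_on UNIV (fourier f)"
  unfolding fourier_eq[abs_def] by (rule continuous_integral_cis)

lemma measurable_fourier: "integrable lborel f \<Longrightarrow> fourier f \<in> borel_measurable borel"
  by (intro borel_measurable_continuous_onI continuous_fourier)

lemma measurable_inverse_fourier: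
  "integrable lborel f \<Longrightarrow> inverse_fourier f \<in> borel_measurable borel"
  unfolding inverse_fourier_eq[abs_def]
  by (intro borel_measurable_divide borel_measurable_const borel_measurable_continuous_onI continuous_integral_cis)

lemma norm_fourier_le: "norm (fourier f \<xi>) \<le> (LINT x|lborel. norm (f x))"
  unfolding fourier_def using integral_norm_bound[of lborel "\<lambda>x. cis (- (x \<bullet> \<xi>)) * f x"]
  by (simp add: norm_mult)

lemma norm_inverse_fourier_le:
  fixes f :: "real^'n::finite \<Rightarrow> complex"
  shows "norm (inverse_fourier f x) \<le> (LINT x|lborel. norm (f x)) / (2 * pi) ^ CARD('n)"
  unfolding inverse_fourier_def using integral_norm_bound[of lborel "\<lambda>\<xi>. cis (x \<bullet> \<xi>) * f \<xi>"]
  by (simp add: norm_mult norm_divide norm_power divide_right_mono)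

lemma integral_fourier_mult:
  "integrable lborel f \<Longrightarrow> integrable lborel g \<Longrightarrow>
    (LINT x|lborel. fourier f x * g x) = (LINT x|lborel. f x * fourier g x)"
  unfolding fourier_eq by (rule integral_cis_mult_swap)

lemma integral_inverse_fourier_mult:
  "integrable lborel f \<Longrightarrow> integrable lborel g \<Longrightarrow>
    (LINT x|lborel. inverse_fourier f x * g x) = (LINT x|lborel. f x * inverse_fourier g x)"
  unfolding inverse_fourier_eq using integral_cis_mult_swap[of f g 1] by simp

section \<open>Gaussian approximate identity and the inversion theorem\<close>

lemma gauss_mollification_tendsto:
  fixes f :: "'a::euclidean_space \<Rightarrow> 'b::{banach, second_countable_topology}"
  assumes f: "continuous_on UNIV f" and M: "\<And>x. norm (f x) \<le> M" and \<delta>: "\<delta> \<longlonglongrightarrow> 0"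
  shows "(\<lambda>k. LINT u|lborel. gauss u *\<^sub>R f (y + \<delta> k *\<^sub>R u)) \<longlonglongrightarrow> sqrt (2 * pi) ^ DIM('a) *\<^sub>R f y"
proof -
  have [measurable]: "f \<in> borel_measurable borel"
    using f by (rule borel_measurable_continuous_onI)
  have "(\<lambda>k. LINT u|lborel. gauss u *\<^sub>R f (y + \<delta> k *\<^sub>R u)) \<longlonglongrightarrow> (LINT u|lborel. gauss (u::'a) *\<^sub>R f y)"
  \<comment> \<open>The width \<open>\<delta> k\<close> sits in the argument of \<open>f\<close> and
    not in the Gaussian, so one integrable function dominates for all \<open>k\<close>.\<close>
  proof (rule integral_dominated_convergence[where w="\<lambda>u::'a. gauss u * M"])
    have "isCont f y"
      using f by (simp add: continuous_on_eq_continuous_at)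
    moreover have "(\<lambda>k. y + \<delta> k *\<^sub>R u) \<longlonglongrightarrow> y" for u
      using tendsto_add[OF tendsto_const tendsto_scaleR[OF \<delta> tendsto_const], of y u] by simp
    ultimately show "AE u in lborel. (\<lambda>k. gauss u *\<^sub>R f (y + \<delta> k *\<^sub>R u)) \<longlonglongrightarrow> gauss u *\<^sub>R f y"
      by (intro AE_I2 tendsto_intros isCont_tendsto_compose[of y f])
    show "AE u in lborel. norm (gauss u *\<^sub>R f (y + \<delta> k *\<^sub>R u)) \<le> gauss u * M" for k
      using M by (auto intro!: mult_left_mono simp: gauss_nonneg)
  qed (auto intro: integrable_gauss)
  then show ?thesis by (simp add: integral_gauss integrable_gauss)
qed

text \<open>Modulation by \<open>cis (x \<bullet> \<xi>)\<close> translates the transform to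
  \<open>\<xi>\<close>, and dilation by \<open>\<delta>\<close> turns the wide Gaussian into one of
  width \<open>\<delta>\<close>: the cutoff becomes a mollifier centred at
  \<open>\<xi>\<close>.\<close>

lemma fourier_modulated_gauss:
  fixes \<xi> :: "real^'n::finite"
  assumes \<delta>: "\<delta> > 0"
  shows "integrable lborel (\<lambda>x. cis (x \<bullet> \<xi>) * complex_of_real (gauss (\<delta> *\<^sub>R x)))" (is "integrable _ ?G")
    and "fourier (\<lambda>x. cis (x \<bullet> \<xi>) * complex_of_real (gauss (\<delta> *\<^sub>R x))) y
       = of_real ((1 / \<delta>) ^ CARD('n) * sqrt (2 * pi) ^ CARD('n) * gauss ((1 / \<delta>) *\<^sub>R (y - \<xi>)))"
proof -
  have "integrable lborel (\<lambda>x::real^'n. gauss (\<delta> *\<^sub>R x))"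
    using integrable_lborel_affine[OF integrable_gauss, of \<delta> 0] \<delta> by simp
  then show int: "integrable lborel ?G"
    by (intro integrable_cis_mult integrable_of_real) auto
  have "fourier ?G y = (LINT x|lborel. cis (- (x \<bullet> y)) * ?G x)"
    by (simp add: fourier_def)
  also have "\<dots> = (LINT x|lborel. cis (x \<bullet> (\<xi> - y)) * complex_of_real (gauss (\<delta> *\<^sub>R x)))"
    by (intro Bochner_Integration.integral_cong refl)
       (simp add: inner_diff_right mult.assoc[symmetric] cis_mult)
  also have "\<dots> = (1 / \<delta>) ^ CARD('n) *\<^sub>R (LINT x|lborel. cis (x \<bullet> ((1 / \<delta>) *\<^sub>R (\<xi> - y))) * complex_of_real (gauss x))"
    using \<delta> \<open>integrable lborel (\<lambda>x::real^'n. gauss (\<delta> *\<^sub>R x))\<close>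
    by (subst integral_lborel_affine[where c="1/\<delta>" and t=0])
       (auto intro!: integrable_cis_mult integrable_of_real)
  also have "\<dots> = of_real ((1 / \<delta>) ^ CARD('n) * sqrt (2 * pi) ^ CARD('n) * gauss ((1 / \<delta>) *\<^sub>R (\<xi> - y)))"
    by (subst integral_cis_gauss) (simp add: scaleR_conv_of_real)
  also have "gauss ((1 / \<delta>) *\<^sub>R (\<xi> - y)) = gauss ((1 / \<delta>) *\<^sub>R (y - \<xi>))"
    by (subst gauss_minus[symmetric]) (simp add: algebra_simps del: gauss_minus)
  finally show "fourier ?G y
       = of_real ((1 / \<delta>) ^ CARD('n) * sqrt (2 * pi) ^ CARD('n) * gauss ((1 / \<delta>) *\<^sub>R (y - \<xi>)))" .
qed

lemma integral_gauss_kernel: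
  fixes f :: "'a::euclidean_space \<Rightarrow> 'b::{banach, second_countable_topology}"
  assumes [measurable]: "f \<in> borel_measurable borel" and M: "\<And>x. norm (f x) \<le> M" and \<delta>: "\<delta> > 0"
  shows "(LINT x|lborel. gauss ((1 / \<delta>) *\<^sub>R (x - y)) *\<^sub>R f x)
       = \<delta> ^ DIM('a) *\<^sub>R (LINT u|lborel. gauss u *\<^sub>R f (y + \<delta> *\<^sub>R u))"
proof -
  have g: "integrable lborel (\<lambda>x::'a. gauss ((1 / \<delta>) *\<^sub>R (x - y)))"
    using integrable_lborel_affine[OF integrable_gauss, of "1/\<delta>" "- (1/\<delta>) *\<^sub>R y"] \<delta>
    by (simp add: algebra_simps)
  have "integrable lborel (\<lambda>x. gauss ((1 / \<delta>) *\<^sub>R (x - y)) *\<^sub>R f x)"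
    by (rule Bochner_Integration.integrable_bound[OF integrable_mult_left[OF g, of M]])
       (use M in \<open>auto intro!: AE_I2 mult_left_mono simp: gauss_nonneg abs_mult intro: order_trans[OF _ abs_ge_self]\<close>)
  then show ?thesis
    using \<delta> by (subst integral_lborel_affine[where c=\<delta> and t=y]) auto
qed

text \<open>The bare character is not integrable, so the multiplication formula cannot be applied to
  it directly. A Gaussian cutoff \<open>?G k\<close> repairs this. As the cutoff is removed,
  dominated convergence gives the inversion integral; moving the transform onto the cutoff turns the
  same quantity into mollifications of \<open>\<phi>\<close> at \<open>\<xi>\<close>.\<close>

theorem inverse_fourier_fourier:
  fixes \<phi> :: "real^'n::finite \<Rightarrow> complex"
  assumes cont: "continuous_on UNIV \<phi>" and M: "\<And>x. norm (\<phi> x) \<le> M"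
    and \<phi>: "integrable lborel \<phi>" and f\<phi>: "integrable lborel (fourier \<phi>)"
  shows "inverse_fourier (fourier \<phi>) \<xi> = \<phi> \<xi>"
proof -
  define \<delta> :: "nat \<Rightarrow> real" where "\<delta> k = inverse (real (Suc k))" for k
  have \<delta>: "\<delta> k > 0" for k by (simp add: \<delta>_def)
  have \<delta>0: "\<delta> \<longlonglongrightarrow> 0" unfolding \<delta>_def by (rule LIMSEQ_inverse_real_of_nat)
  have [measurable]: "\<phi> \<in> borel_measurable borel" "fourier \<phi> \<in> borel_measurable borel"
    using borel_measurable_integrable[OF \<phi>] borel_measurable_integrable[OF f\<phi>] by simp_all
  let ?G = "\<lambda>k x. cis (x \<bullet> \<xi>) * complex_of_real (gauss (\<delta> k *\<^sub>R x))"
  have 1: "(\<lambda>k. LINT x|lborel. fourier \<phi> x * ?G k x) \<longlonglongrightarrow> (LINT x|lborel. fourier \<phi> x * cis (x \<bullet> \<xi>))"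
  proof (rule integral_dominated_convergence[where w="\<lambda>x. norm (fourier \<phi> x)"])
    have g: "isCont gauss (0::real^'n)"
      unfolding gauss_def by (intro continuous_intros) auto
    have "(\<lambda>k. gauss (\<delta> k *\<^sub>R x)) \<longlonglongrightarrow> 1" for x :: "real^'n"
      using isCont_tendsto_compose[OF g, of "\<lambda>k. \<delta> k *\<^sub>R x"] tendsto_scaleR[OF \<delta>0 tendsto_const, of x]
      by simp
    from tendsto_mult[OF tendsto_const tendsto_mult[OF tendsto_const tendsto_of_real[OF this]]]
    show "AE x in lborel. (\<lambda>k. fourier \<phi> x * ?G k x) \<longlonglongrightarrow> fourier \<phi> x * cis (x \<bullet> \<xi>)"
      by (fastforce intro: AE_I2)
    show "AE x in lborel. norm (fourier \<phi> x * ?G k x) \<le> norm (fourier \<phi> x)" for k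
      by (auto intro!: AE_I2 mult_left_le simp: norm_mult gauss_le_1 gauss_nonneg)
  qed (use f\<phi> in auto)
  have 2: "(LINT x|lborel. fourier \<phi> x * ?G k x)
      = sqrt (2 * pi) ^ CARD('n) *\<^sub>R (LINT u|lborel. gauss u *\<^sub>R \<phi> (\<xi> + \<delta> k *\<^sub>R u))" for k
  proof -
    have "(LINT x|lborel. fourier \<phi> x * ?G k x) = (LINT x|lborel. \<phi> x * fourier (?G k) x)"
      by (intro integral_fourier_mult \<phi> fourier_modulated_gauss \<delta>)
    also have "\<dots> = (LINT x|lborel. ((1 / \<delta> k) ^ CARD('n) * sqrt (2 * pi) ^ CARD('n)) *\<^sub>R (gauss ((1 / \<delta> k) *\<^sub>R (x - \<xi>)) *\<^sub>R \<phi> x))"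
      by (intro Bochner_Integration.integral_cong refl, subst fourier_modulated_gauss(2)[OF \<delta>])
         (simp add: scaleR_conv_of_real mult_ac del: scaleR_scaleR)
    also have "\<dots> = ((1 / \<delta> k) ^ CARD('n) * sqrt (2 * pi) ^ CARD('n)) *\<^sub>R
        (\<delta> k ^ CARD('n) *\<^sub>R (LINT u|lborel. gauss u *\<^sub>R \<phi> (\<xi> + \<delta> k *\<^sub>R u)))"
      using integral_gauss_kernel[OF _ M \<delta>[of k], where y=\<xi>] by (subst integral_scaleR_right) simp
    also have "\<dots> = sqrt (2 * pi) ^ CARD('n) *\<^sub>R (LINT u|lborel. gauss u *\<^sub>R \<phi> (\<xi> + \<delta> k *\<^sub>R u))"
      using \<delta>[of k] by (simp add: power_divide)
    finally show ?thesis .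
  qed
  \<comment> \<open>One factor \<open>sqrt (2 * pi) ^ CARD('n)\<close> comes from the transform of
    the Gaussian, the other is the mass of \<open>gauss\<close>; their product is the constant in
    \<open>inverse_fourier\<close>.\<close>
  have "(\<lambda>k. LINT x|lborel. fourier \<phi> x * ?G k x) \<longlonglongrightarrow>
      sqrt (2 * pi) ^ CARD('n) *\<^sub>R (sqrt (2 * pi) ^ CARD('n) *\<^sub>R \<phi> \<xi>)"
    unfolding 2 using gauss_mollification_tendsto[OF cont M \<delta>0, of \<xi>] by (intro tendsto_intros) simp
  with 1 have "(LINT x|lborel. fourier \<phi> x * cis (x \<bullet> \<xi>)) =
      (sqrt (2 * pi) ^ CARD('n) * sqrt (2 * pi) ^ CARD('n)) *\<^sub>R \<phi> \<xi>"
    using LIMSEQ_unique by fastforce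
  also have "sqrt (2 * pi) ^ CARD('n) * sqrt (2 * pi) ^ CARD('n) = (2 * pi) ^ CARD('n)"
    unfolding power_mult_distrib[symmetric] by (subst real_sqrt_mult_self) simp
  finally show ?thesis
    by (simp add: inverse_fourier_def inner_commute mult.commute scaleR_conv_of_real)
qed

subsection \<open>Decay of the Fourier transform\<close>

lemma fourier_translate:
  fixes f :: "real^'n::finite \<Rightarrow> complex"
  assumes f: "integrable lborel f"
  shows "fourier (\<lambda>x. f (x + a)) \<xi> = cis (a \<bullet> \<xi>) * fourier f \<xi>"
proof -
  have int: "integrable lborel (\<lambda>x. cis (- ((x - a) \<bullet> \<xi>)) * f x)"
    by (intro integrable_cis_mult f) simp
  have "fourier (\<lambda>x. f (x + a)) \<xi> = (LINT x|lborel. cis (- ((x - a) \<bullet> \<xi>)) * f x)"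
    unfolding fourier_def using integral_lborel_affine[OF int, of 1 a] by (simp add: add.commute)
  also have "\<dots> = (LINT x|lborel. cis (a \<bullet> \<xi>) * (cis (- (x \<bullet> \<xi>)) * f x))"
    by (intro Bochner_Integration.integral_cong refl)
       (simp add: inner_diff_left mult.assoc[symmetric] cis_mult)
  finally show ?thesis by (simp add: fourier_def)
qed

lemma has_vector_derivative_line:
  assumes "f differentiable (at (x + s *\<^sub>R axis i 1))"
  shows "((\<lambda>s. f (x + s *\<^sub>R axis i 1)) has_vector_derivative partial_deriv i f (x + s *\<^sub>R axis i 1)) (at s)"
proof -
  let ?D = "frechet_derivative f (at (x + s *\<^sub>R axis i 1))"
  have D: "(f has_derivative ?D) (at (x + s *\<^sub>R axis i 1))"
    using assms frechet_derivative_works by blast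
  have "((\<lambda>s. x + s *\<^sub>R axis i 1) has_derivative (\<lambda>h. h *\<^sub>R axis i 1)) (at s)"
    by (auto intro!: derivative_eq_intros)
  from has_derivative_compose[OF this D]
  have "((\<lambda>s. f (x + s *\<^sub>R axis i 1)) has_derivative (\<lambda>h. ?D (h *\<^sub>R axis i 1))) (at s)" .
  then show ?thesis
    unfolding has_vector_derivative_def partial_deriv_def
    by (simp add: linear_scale[OF has_derivative_linear[OF D]])
qed

lemma difference_quotient_tendsto:
  fixes g :: "real \<Rightarrow> 'a::real_normed_vector"
  assumes g: "(g has_vector_derivative v) (at 0)" and t: "t \<longlonglongrightarrow> 0" "\<And>k. t k \<noteq> 0"
  shows "(\<lambda>k. (1 / t k) *\<^sub>R (g (t k) - g 0)) \<longlonglongrightarrow> v"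
proof -
  have "((\<lambda>h. norm (g (0 + h) - g 0 - h *\<^sub>R v) / norm h) \<longlongrightarrow> 0) (at 0)"
    using g unfolding has_vector_derivative_def has_derivative_at by blast
  moreover have "filterlim t (at 0) sequentially"
    using t by (simp add: filterlim_at)
  ultimately have "(\<lambda>k. norm (g (0 + t k) - g 0 - t k *\<^sub>R v) / norm (t k)) \<longlonglongrightarrow> 0"
    by (rule filterlim_compose)
  moreover have "norm (g (0 + t k) - g 0 - t k *\<^sub>R v) / norm (t k) = norm ((1 / t k) *\<^sub>R (g (t k) - g 0) - v)" for k
  proof -
    have "(1 / t k) *\<^sub>R (g (t k) - g 0) - v = (1 / t k) *\<^sub>R (g (0 + t k) - g 0 - t k *\<^sub>R v)"
      using t(2)[of k] by (simp add: algebra_simps)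
    then show ?thesis by simp
  qed
  ultimately show ?thesis
    by (simp add: tendsto_norm_zero_iff LIM_zero_iff)
qed

text \<open>Difference quotients of \<open>f\<close> turn translation covariance into the differentiation rule, so that
  no integration by parts is needed.\<close>

lemma fourier_partial_deriv:
  fixes f :: "real^'n::finite \<Rightarrow> complex"
  assumes f: "schwartz f"
  shows "fourier (partial_deriv i f) \<xi> = \<i> * of_real (\<xi> $ i) * fourier f \<xi>"
proof -
  define t :: "nat \<Rightarrow> real" where "t k = inverse (real (Suc k))" for k
  have t: "t k > 0" "t k \<noteq> 0" "t k \<le> 1" for k by (simp_all add: t_def inverse_eq_divide)
  have t0: "t \<longlonglongrightarrow> 0" unfolding t_def by (rule LIMSEQ_inverse_real_of_nat)
  let ?e = "axis i 1 :: real^'n"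
  let ?m = "2 * DIM(real^'n)"
  define D where "D k x = (1 / t k) *\<^sub>R (f (x + t k *\<^sub>R ?e) - f x)" for k x
  have [measurable]: "f \<in> borel_measurable borel" "partial_deriv i f \<in> borel_measurable borel"
    by (intro schwartz_measurable schwartz_partial_deriv f)+
  obtain B where B: "\<And>x. (1 + norm x) ^ ?m * norm (partial_deriv i f x) \<le> B"
    using schwartz_decay[OF schwartz_partial_deriv[OF f]] by metis
  have line: "((\<lambda>s. f (x + s *\<^sub>R ?e)) has_vector_derivative partial_deriv i f (x + s *\<^sub>R ?e)) (at s)" for x s
    by (intro has_vector_derivative_line schwartz_differentiable f)
  \<comment> \<open>The dominating function for the difference quotients: by the mean value
    inequality they are controlled by the partial derivative on a segment of length
    \<open>t k \<le> 1\<close>. On it \<open>1 + norm x\<close> is at most twice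
    \<open>1 + norm z\<close>, where \<open>z\<close> is the point of the segment, which costs the
    factor \<open>2 ^ ?m\<close>.\<close>
  have D_bound: "norm (D k x) \<le> 2 ^ ?m * B * inverse ((1 + norm x) ^ ?m)" for k x
  proof -
    let ?K = "2 ^ ?m * B * inverse ((1 + norm x) ^ ?m)"
    have pd: "norm (partial_deriv i f (x + s *\<^sub>R ?e)) \<le> ?K" if s: "0 \<le> s" "s \<le> 1" for s
    proof -
      let ?z = "x + s *\<^sub>R ?e"
      have "norm x \<le> norm ?z + norm (s *\<^sub>R ?e)"
        using norm_triangle_ineq4[of ?z "s *\<^sub>R ?e"] by simp
      also have "norm (s *\<^sub>R ?e) \<le> 1" using s by simp
      finally have "1 + norm x \<le> 2 * (1 + norm ?z)"
        using norm_ge_zero[of ?z] unfolding distrib_left by linarith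
      then have "(1 + norm x) ^ ?m \<le> (2 * (1 + norm ?z)) ^ ?m"
        by (intro power_mono) auto
      then have "(1 + norm x) ^ ?m * norm (partial_deriv i f ?z) \<le> (2 * (1 + norm ?z)) ^ ?m * norm (partial_deriv i f ?z)"
        by (intro mult_right_mono) auto
      also have "\<dots> \<le> 2 ^ ?m * B"
        using B[of ?z] by (simp only: power_mult_distrib mult.assoc) simp
      finally have "(1 + norm x) ^ ?m * norm (partial_deriv i f ?z) \<le> 2 ^ ?m * B" .
      moreover have "(1 + norm x) ^ ?m > 0" by (intro zero_less_power) (simp add: add_pos_nonneg)
      ultimately show ?thesis by (simp add: field_simps del: power_mult power_mult_distrib)
    qed
    have "norm (f (x + t k *\<^sub>R ?e) - f (x + 0 *\<^sub>R ?e)) \<le> ?K * t k - ?K * 0"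
    proof (rule differentiable_bound_general[where f="\<lambda>s. f (x + s *\<^sub>R ?e)" and \<phi>="\<lambda>s. ?K * s"])
      show "continuous_on {0..t k} (\<lambda>s. f (x + s *\<^sub>R ?e))"
        by (intro continuous_on_compose2[OF schwartz_continuous[OF f, of UNIV]] continuous_intros) auto
      show "continuous_on {0..t k} ((*) ?K)"
        by (intro continuous_intros)
      show "((*) ?K has_vector_derivative ?K) (at s)" for s
        using DERIV_cmult_Id has_real_derivative_iff_has_vector_derivative by blast
      show "norm (partial_deriv i f (x + s *\<^sub>R ?e)) \<le> ?K" if "0 < s" "s < t k" for s
        using that t(3)[of k] by (intro pd) auto
    qed (use t line in auto)
    then have "norm (f (x + t k *\<^sub>R ?e) - f x) / t k \<le> ?K"
      using t(1)[of k] by (subst pos_divide_le_eq) simp_all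
    moreover have "norm (D k x) = norm (f (x + t k *\<^sub>R ?e) - f x) / t k"
      unfolding D_def norm_scaleR using t(1)[of k] by simp
    ultimately show ?thesis by simp
  qed
  have "(\<lambda>k. fourier (D k) \<xi>) \<longlonglongrightarrow> fourier (partial_deriv i f) \<xi>"
    unfolding fourier_def
  proof (rule integral_dominated_convergence[where w="\<lambda>x. 2 ^ ?m * B * inverse ((1 + norm x) ^ ?m)"])
    show "(\<lambda>x. cis (- (x \<bullet> \<xi>)) * D k x) \<in> borel_measurable lborel" for k
      unfolding D_def by measurable
    show "integrable lborel (\<lambda>x::real^'n. 2 ^ ?m * B * inverse ((1 + norm x) ^ ?m))"
      by (intro integrable_mult_right integrable_inverse_one_plus_norm)
    have "(\<lambda>k. D k x) \<longlonglongrightarrow> partial_deriv i f x" for x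
      using difference_quotient_tendsto[of "\<lambda>s. f (x + s *\<^sub>R ?e)", OF _ t0 t(2)] line[of x 0]
      by (simp add: D_def)
    then show "AE x in lborel. (\<lambda>k. cis (- (x \<bullet> \<xi>)) * D k x) \<longlonglongrightarrow> cis (- (x \<bullet> \<xi>)) * partial_deriv i f x"
      by (intro AE_I2 tendsto_mult tendsto_const)
    show "AE x in lborel. norm (cis (- (x \<bullet> \<xi>)) * D k x) \<le> 2 ^ ?m * B * inverse ((1 + norm x) ^ ?m)" for k
      using D_bound by (simp add: norm_mult)
  qed measurable
  \<comment> \<open>The number 1 is written \<open>cis (0 * \<xi> $ i)\<close> so that the
    right-hand side is visibly a difference quotient at 0 of
    \<open>s \<mapsto> cis (s * \<xi> $ i)\<close>, whose derivative there is
    \<open>\<i> * of_real (\<xi> $ i)\<close>.\<close>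
  moreover have "fourier (D k) \<xi> = (1 / t k) *\<^sub>R (cis (t k * \<xi> $ i) - cis (0 * \<xi> $ i)) * fourier f \<xi>" for k
  proof -
    have f1: "integrable lborel (\<lambda>x. f (x + t k *\<^sub>R ?e))"
      using integrable_lborel_affine[OF schwartz_integrable[OF f], of 1 "t k *\<^sub>R ?e"] by (simp add: add.commute)
    have "fourier (D k) \<xi> = (1 / t k) *\<^sub>R (fourier (\<lambda>x. f (x + t k *\<^sub>R ?e)) \<xi> - fourier f \<xi>)"
      unfolding fourier_def D_def mult_scaleR_right right_diff_distrib
      by (simp add: Bochner_Integration.integral_diff integrable_cis_mult f1 schwartz_integrable f)
    also have "fourier (\<lambda>x. f (x + t k *\<^sub>R ?e)) \<xi> = cis (t k * \<xi> $ i) * fourier f \<xi>"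
      by (simp add: fourier_translate schwartz_integrable f inner_axis' )
    finally show ?thesis by (simp add: algebra_simps)
  qed
  moreover have "(\<lambda>k. (1 / t k) *\<^sub>R (cis (t k * \<xi> $ i) - cis (0 * \<xi> $ i)) * fourier f \<xi>) \<longlonglongrightarrow> (\<i> * of_real (\<xi> $ i)) * fourier f \<xi>"
  proof (intro tendsto_mult tendsto_const difference_quotient_tendsto[where g="\<lambda>s. cis (s * \<xi> $ i)"] t0 t(2))
    have "((\<lambda>z. exp (\<i> * (z * of_real (\<xi> $ i)))) has_field_derivative \<i> * of_real (\<xi> $ i)) (at (of_real 0))"
      by (auto intro!: derivative_eq_intros)
    from has_vector_derivative_real_field[OF this]
    show "((\<lambda>s. cis (s * \<xi> $ i)) has_vector_derivative \<i> * of_real (\<xi> $ i)) (at 0)"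
      by (simp add: cis_conv_exp)
  qed
  ultimately show ?thesis
    using LIMSEQ_unique by fastforce
qed

text \<open>One factor \<open>\<bar>\<xi> $ i\<bar>\<close> is absorbed by replacing
  \<open>f\<close> by its partial derivative, which is again Schwartz; hence the induction on
  \<open>k\<close> runs over all \<open>f\<close>.\<close>

lemma fourier_coordinate_decay:
  fixes f :: "real^'n::finite \<Rightarrow> complex"
  assumes "schwartz f"
  shows "\<exists>B. \<forall>\<xi>. \<bar>\<xi> $ i\<bar> ^ k * norm (fourier f \<xi>) \<le> B"
  using assms
proof (induction k arbitrary: f)
  case 0
  then show ?case using norm_fourier_le[of f] by auto
next
  case (Suc k)
  obtain B where "\<And>\<xi>. \<bar>\<xi> $ i\<bar> ^ k * norm (fourier (partial_deriv i f) \<xi>) \<le> B"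
    using Suc.IH[OF schwartz_partial_deriv[OF Suc.prems]] by auto
  then have "\<bar>\<xi> $ i\<bar> ^ Suc k * norm (fourier f \<xi>) \<le> B" for \<xi>
    by (simp add: fourier_partial_deriv[OF Suc.prems] norm_mult mult_ac)
  then show ?case by blast
qed

lemma norm_le_card_mult_coordinate:
  obtains j where "norm (\<xi> :: real^'n::finite) \<le> real CARD('n) * \<bar>\<xi> $ j\<bar>"
proof -
  obtain j where j: "\<And>i. \<bar>\<xi> $ i\<bar> \<le> \<bar>\<xi> $ j\<bar>"
    using Max_in[of "range (\<lambda>i. \<bar>\<xi> $ i\<bar>)"] Max_ge[of "range (\<lambda>i. \<bar>\<xi> $ i\<bar>)"]
    by fastforce
  have "norm \<xi> \<le> (\<Sum>i\<in>UNIV. \<bar>\<xi> $ i\<bar>)" by (rule norm_le_l1_cart)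
  also have "\<dots> \<le> real CARD('n) * \<bar>\<xi> $ j\<bar>"
    using sum_bounded_above[of UNIV "\<lambda>i. \<bar>\<xi> $ i\<bar>" "\<bar>\<xi> $ j\<bar>"] j by simp
  finally show ?thesis by (rule that)
qed

text \<open>Decay is known only for powers of single coordinates. The largest coordinate controls
  the norm up to the factor \<open>CARD('n)\<close>; as its index varies with \<open>\<xi>\<close>,
  the bounds \<open>B i\<close> are summed to obtain one constant.\<close>

lemma fourier_decay:
  fixes f :: "real^'n::finite \<Rightarrow> complex"
  assumes f: "schwartz f"
  obtains B where "\<And>\<xi>. (1 + norm \<xi>) ^ k * norm (fourier f \<xi>) \<le> B"
proof -
  obtain B where B: "\<And>i \<xi>. \<bar>\<xi> $ i\<bar> ^ k * norm (fourier f \<xi>) \<le> B i"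
    using fourier_coordinate_decay[OF f, of _ k] by metis
  have B0: "B i \<ge> 0" for i
    by (rule order_trans[OF _ B[of 0 i]]) simp
  have "norm \<xi> ^ k * norm (fourier f \<xi>) \<le> real CARD('n) ^ k * (\<Sum>i\<in>UNIV. B i)" for \<xi>
  proof -
    obtain j where j: "norm \<xi> \<le> real CARD('n) * \<bar>\<xi> $ j\<bar>" by (rule norm_le_card_mult_coordinate)
    then have "norm \<xi> ^ k \<le> real CARD('n) ^ k * \<bar>\<xi> $ j\<bar> ^ k"
      using power_mono[OF j, of k] by (simp add: power_mult_distrib)
    then have "norm \<xi> ^ k * norm (fourier f \<xi>) \<le> real CARD('n) ^ k * \<bar>\<xi> $ j\<bar> ^ k * norm (fourier f \<xi>)"
      by (intro mult_right_mono) auto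
    also have "\<dots> \<le> real CARD('n) ^ k * B j"
      using B[of \<xi> j] by (simp add: mult.assoc mult_left_mono)
    also have "\<dots> \<le> real CARD('n) ^ k * (\<Sum>i\<in>UNIV. B i)"
      by (intro mult_left_mono member_le_sum) (auto intro: B0)
    finally show ?thesis .
  qed
  note 1 = this
  have "(1 + norm \<xi>) ^ k * norm (fourier f \<xi>) \<le>
      2 ^ k * ((LINT x|lborel. norm (f x)) + real CARD('n) ^ k * (\<Sum>i\<in>UNIV. B i))" for \<xi>
  proof -
    have "(1 + norm \<xi>) ^ k * norm (fourier f \<xi>) \<le> 2 ^ k * (1 + norm \<xi> ^ k) * norm (fourier f \<xi>)"
      by (intro mult_right_mono one_plus_power_le) auto
    also have "\<dots> = 2 ^ k * (norm (fourier f \<xi>) + norm \<xi> ^ k * norm (fourier f \<xi>))"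
      by (simp add: algebra_simps)
    also have "\<dots> \<le> 2 ^ k * ((LINT x|lborel. norm (f x)) + real CARD('n) ^ k * (\<Sum>i\<in>UNIV. B i))"
      by (intro mult_left_mono add_mono 1 norm_fourier_le) auto
    finally show ?thesis .
  qed
  then show ?thesis by (rule that)
qed

lemma schwartz_integrable_fourier:
  fixes f :: "real^'n::finite \<Rightarrow> complex"
  assumes f: "schwartz f"
  shows "integrable lborel (fourier f)"
  by (rule fourier_decay[OF f, of "2 * DIM(real^'n)"], rule integrable_of_decay)
     (auto intro: measurable_fourier schwartz_integrable f)

lemma schwartz_inverse_fourier_fourier:
  fixes f :: "real^'n::finite \<Rightarrow> complex"
  assumes f: "schwartz f"
  shows "inverse_fourier (fourier f) \<xi> = f \<xi>"
  using schwartz_bounded[OF f]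
  by (metis f inverse_fourier_fourier schwartz_continuous schwartz_integrable schwartz_integrable_fourier)

subsection \<open>Gaussians are Schwartz functions\<close>

lemma real_polynomial_function_growth:
  fixes p :: "'a::real_normed_vector \<Rightarrow> real"
  assumes "real_polynomial_function p"
  shows "\<exists>B k. \<forall>x. \<bar>p x\<bar> \<le> B * (1 + norm x) ^ k"
  using assms
proof (induction rule: real_polynomial_function.induct)
  case (linear f)
  then obtain K where "K > 0" "\<And>x. norm (f x) \<le> norm x * K"
    using bounded_linear.pos_bounded by blast
  then have "\<bar>f x\<bar> \<le> K * (1 + norm x) ^ 1" for x
    by (simp add: algebra_simps) (smt (verit, ccfv_threshold))
  then show ?case by blast
next
  case (const c)
  show ?case by (intro exI[of _ "\<bar>c\<bar>"] exI[of _ 0]) simp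
next
  case (add f g)
  then obtain A k B l where A: "\<And>x. \<bar>f x\<bar> \<le> A * (1 + norm x) ^ k"
    and B: "\<And>x. \<bar>g x\<bar> \<le> B * (1 + norm x) ^ l" by blast
  have AB: "A \<ge> 0" "B \<ge> 0"
    using order_trans[OF abs_ge_zero A[of 0]] order_trans[OF abs_ge_zero B[of 0]] by simp_all
  have "\<bar>f x + g x\<bar> \<le> (A + B) * (1 + norm x) ^ (k + l)" for x
  proof -
    have "\<bar>f x + g x\<bar> \<le> A * (1 + norm x) ^ k + B * (1 + norm x) ^ l"
      using A[of x] B[of x] by linarith
    also have "\<dots> \<le> A * (1 + norm x) ^ (k + l) + B * (1 + norm x) ^ (k + l)"
      using AB by (intro add_mono mult_left_mono power_increasing) auto
    finally show ?thesis by (simp add: algebra_simps)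
  qed
  then show ?case by blast
next
  case (mult f g)
  then obtain A k B l where A: "\<And>x. \<bar>f x\<bar> \<le> A * (1 + norm x) ^ k"
    and B: "\<And>x. \<bar>g x\<bar> \<le> B * (1 + norm x) ^ l" by blast
  have "\<bar>f x * g x\<bar> \<le> (A * B) * (1 + norm x) ^ (k + l)" for x
    using mult_mono[OF A[of x] B[of x] order_trans[OF abs_ge_zero A[of x]]]
    by (simp add: abs_mult power_add mult_ac)
  then show ?case by blast
qed

text \<open>Fixing the direction \<open>v\<close> keeps the derivative a scalar polynomial, so that
  differentiation can be iterated.\<close>

lemma real_polynomial_function_has_derivative:
  fixes p :: "'a::real_normed_vector \<Rightarrow> real"
  assumes "real_polynomial_function p"
  shows "\<exists>D. (\<forall>x. (p has_derivative D x) (at x)) \<and> (\<forall>v. real_polynomial_function (\<lambda>x. D x v))"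
  using assms
proof (induction rule: real_polynomial_function.induct)
  case (linear f)
  then show ?case
    by (intro exI[of _ "\<lambda>x. f"]) (auto intro: bounded_linear_imp_has_derivative)
next
  case (const c)
  show ?case by (intro exI[of _ "\<lambda>x h. 0"]) auto
next
  case (add f g)
  then obtain D E where "\<And>x. (f has_derivative D x) (at x)" "\<And>v. real_polynomial_function (\<lambda>x. D x v)"
    "\<And>x. (g has_derivative E x) (at x)" "\<And>v. real_polynomial_function (\<lambda>x. E x v)"
    by blast
  then show ?case
    by (intro exI[of _ "\<lambda>x h. D x h + E x h"]) (auto intro!: derivative_intros)
next
  case (mult f g)
  then obtain D E where "\<And>x. (f has_derivative D x) (at x)" "\<And>v. real_polynomial_function (\<lambda>x. D x v)"
    "\<And>x. (g has_derivative E x) (at x)" "\<And>v. real_polynomial_function (\<lambda>x. E x v)"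
    by blast
  with mult.hyps show ?case
    by (intro exI[of _ "\<lambda>x h. f x * E x h + D x h * g x"])
       (auto intro!: derivative_intros real_polynomial_function.intros(3,4))
qed

text \<open>Polynomials times a fixed Gaussian form a class closed under partial derivatives, which
  is the induction step for derivatives of all orders.\<close>

lemma polynomial_mult_exp_derivative:
  fixes y :: "real^'n::finite"
  assumes p: "real_polynomial_function p"
  obtains q where "real_polynomial_function q"
    "\<And>x. ((\<lambda>x. complex_of_real (p x * exp (- (c * ((x - y) \<bullet> (x - y)))))) differentiable (at x))"
    "partial_deriv i (\<lambda>x. complex_of_real (p x * exp (- (c * ((x - y) \<bullet> (x - y))))))
     = (\<lambda>x. complex_of_real (q x * exp (- (c * ((x - y) \<bullet> (x - y))))))"
proof -
  obtain D where D: "\<And>x. (p has_derivative D x) (at x)" and Dp: "\<And>v. real_polynomial_function (\<lambda>x. D x v)"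
    using real_polynomial_function_has_derivative[OF p] by blast
  \<comment> \<open>Product rule, with \<open>(x - y) \<bullet> h\<close> split into a linear and a
    constant part so that the introduction rules for polynomials match it.\<close>
  define q where "q x h = D x h + p x * ((- 2 * c) * (x \<bullet> h + (- (y \<bullet> h))))" for x h
  let ?E = "\<lambda>x. exp (- (c * ((x - y) \<bullet> (x - y))))"
  have q: "real_polynomial_function (\<lambda>x. q x h)" for h
    unfolding q_def
    by (intro real_polynomial_function.intros(2-4) Dp p real_polynomial_function.intros(1)[OF bounded_linear_inner_left])
  have "((\<lambda>x. p x * ?E x) has_derivative (\<lambda>h. q x h * ?E x)) (at x)" for x
    unfolding q_def
    by (rule derivative_eq_intros D refl)+ (auto simp: fun_eq_iff algebra_simps inner_commute)
  from has_derivative_of_real[OF this]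
  have der: "((\<lambda>x. complex_of_real (p x * ?E x)) has_derivative (\<lambda>h. complex_of_real (q x h * ?E x))) (at x)" for x .
  show ?thesis
  proof (rule that[of "\<lambda>x. q x (axis i 1)"])
    show "(\<lambda>x. complex_of_real (p x * ?E x)) differentiable (at x)" for x
      using der differentiable_def by blast
    show "partial_deriv i (\<lambda>x. complex_of_real (p x * ?E x)) = (\<lambda>x. complex_of_real (q x (axis i 1) * ?E x))"
      unfolding partial_deriv_def using frechet_derivative_at[OF der] by metis
  qed (rule q)
qed

lemma schwartz_gaussian:
  fixes y :: "real^'n::finite"
  assumes c: "c > 0"
  shows "schwartz (\<lambda>x. complex_of_real (exp (- (c * (norm (x - y))\<^sup>2))))"
proof -
  let ?E = "\<lambda>x. exp (- (c * ((x - y) \<bullet> (x - y))))"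
  have *: "\<exists>p. real_polynomial_function p \<and>
      partial_derivs is (\<lambda>x. complex_of_real (?E x)) = (\<lambda>x. complex_of_real (p x * ?E x))" for "is"
  proof (induction "is")
    case Nil
    show ?case by (intro exI[of _ "\<lambda>x. 1"]) (auto simp: partial_derivs_def)
  next
    case (Cons i "is")
    then obtain p where p: "real_polynomial_function p"
      "partial_derivs is (\<lambda>x. complex_of_real (?E x)) = (\<lambda>x. complex_of_real (p x * ?E x))" by blast
    obtain q where q: "real_polynomial_function q"
      "partial_deriv i (\<lambda>x. complex_of_real (p x * ?E x)) = (\<lambda>x. complex_of_real (q x * ?E x))"
      by (rule polynomial_mult_exp_derivative[OF p(1), of c y i])
    have "partial_derivs (i # is) (\<lambda>x. complex_of_real (?E x))
        = partial_deriv i (partial_derivs is (\<lambda>x. complex_of_real (?E x)))"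
      by (simp add: partial_derivs_def)
    also have "\<dots> = (\<lambda>x. complex_of_real (q x * ?E x))"
      unfolding p(2) by (rule q(2))
    finally show ?case using q(1) by blast
  qed
  have "schwartz (\<lambda>x. complex_of_real (?E x))"
    unfolding schwartz_def
  proof (intro conjI allI)
    fix "is" k
    obtain p where p: "real_polynomial_function p"
      and eq: "partial_derivs is (\<lambda>x. complex_of_real (?E x)) = (\<lambda>x. complex_of_real (p x * ?E x))"
      using * by blast
    show "partial_derivs is (\<lambda>x. complex_of_real (?E x)) differentiable_on UNIV"
      unfolding eq differentiable_on_def using polynomial_mult_exp_derivative[OF p, of c y] by auto
    obtain A m where A: "\<And>x. \<bar>p x\<bar> \<le> A * (1 + norm x) ^ m"
      using real_polynomial_function_growth[OF p] by blast
    have A0: "A \<ge> 0" using order_trans[OF abs_ge_zero A[of 0]] by simp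
    obtain B where B: "\<And>r. r \<ge> 0 \<Longrightarrow> (1 + r) ^ (k + m) * exp (- (c * r\<^sup>2)) \<le> B"
      using polynomial_mult_exp_square_bounded[OF c] by meson
    have "norm x ^ k * norm (complex_of_real (p x * ?E x)) \<le> A * ((1 + norm y) ^ (k + m) * B)" for x
    proof -
      have "norm x \<le> norm y + norm (x - y)"
        using norm_triangle_ineq[of y "x - y"] by simp
      \<comment> \<open>This moves the polynomial growth from the origin to the centre
        \<open>y\<close> of the Gaussian at the price of a constant depending on
        \<open>y\<close>.\<close>
      then have le: "1 + norm x \<le> (1 + norm y) * (1 + norm (x - y))"
        using mult_nonneg_nonneg[OF norm_ge_zero[of y] norm_ge_zero[of "x - y"]]
        unfolding distrib_left distrib_right by linarith
      have "norm x ^ k * \<bar>p x\<bar> \<le> (1 + norm x) ^ k * (A * (1 + norm x) ^ m)"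
        by (intro mult_mono A power_mono) auto
      also have "\<dots> = A * (1 + norm x) ^ (k + m)" by (simp add: power_add)
      also have "\<dots> \<le> A * ((1 + norm y) * (1 + norm (x - y))) ^ (k + m)"
        by (intro mult_left_mono power_mono le A0) auto
      finally have "norm x ^ k * \<bar>p x\<bar> * ?E x \<le> A * ((1 + norm y) * (1 + norm (x - y))) ^ (k + m) * ?E x"
        by (intro mult_right_mono) auto
      also have "\<dots> = A * ((1 + norm y) ^ (k + m) * ((1 + norm (x - y)) ^ (k + m) * exp (- (c * (norm (x - y))\<^sup>2))))"
        by (simp add: power_mult_distrib power2_norm_eq_inner mult_ac)
      also have "\<dots> \<le> A * ((1 + norm y) ^ (k + m) * B)"
        by (intro mult_left_mono B A0) auto
      finally show ?thesis by (simp add: norm_mult abs_mult mult_ac)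
    qed
    then show "\<exists>B. \<forall>x. norm x ^ k * norm (partial_derivs is (\<lambda>x. complex_of_real (?E x)) x) \<le> B"
      unfolding eq by blast
  qed
  then show ?thesis by (simp add: power2_norm_eq_inner)
qed

subsection \<open>Gaussian mollification in weighted spaces\<close>

text \<open>Peetre's inequality: a translation by \<open>v\<close> changes the Sobolev weight at
  most by a factor of polynomial growth in \<open>v\<close>, uniformly in \<open>x\<close>.\<close>

lemma powr_japanese_bracket_shift:
  fixes x v :: "'a::real_normed_vector"
  shows "(1 + (norm (x + v))\<^sup>2) powr p \<le> (1 + (norm x)\<^sup>2) powr p * (1 + norm v) powr (2 * \<bar>p\<bar>)"
proof -
  have bracket: "1 + (norm (a + b))\<^sup>2 \<le> (1 + (norm a)\<^sup>2) * (1 + norm b)\<^sup>2" for a b :: 'a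
  proof -
    have "(norm (a + b))\<^sup>2 \<le> (norm a + norm b)\<^sup>2"
      by (intro power_mono norm_triangle_ineq) auto
    \<comment> \<open>Writing A and B for the two norms, (1 + A^2)(1 + B)^2 - 1 - (A + B)^2 = (A -
      1)^2 B + B + A^2 B + A^2 B^2, and these are the four terms listed.\<close>
    moreover have "0 \<le> (norm a - 1)\<^sup>2 * norm b"  "0 \<le> norm a * norm a * norm b"
        "0 \<le> norm a * norm a * (norm b * norm b)" "0 \<le> norm b"
      by auto
    ultimately show ?thesis
      by (simp only: power2_eq_square algebra_simps)
  qed
  have pos: "1 + (norm a)\<^sup>2 > 0" for a :: 'a
    by (simp add: add_pos_nonneg)
  have v: "((1 + norm v)\<^sup>2) powr q = (1 + norm v) powr (2 * q)" for q
    using powr_powr[of "1 + norm v" 2 q] by (simp add: add_pos_nonneg)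
  show ?thesis
  proof (cases "p \<ge> 0")
    case True
    have "(1 + (norm (x + v))\<^sup>2) powr p \<le> ((1 + (norm x)\<^sup>2) * (1 + norm v)\<^sup>2) powr p"
      using True pos[of "x + v"] by (intro powr_mono2 bracket) auto
    then show ?thesis using True pos[of x] by (simp add: powr_mult v)
  next
    case False
    \<comment> \<open>A negative exponent reverses monotonicity, so the bracket inequality is used
      in the opposite direction, returning from \<open>x + v\<close> to \<open>x\<close> by
      \<open>- v\<close>.\<close>
    have "((1 + (norm (x + v))\<^sup>2) * (1 + norm v)\<^sup>2) powr p \<le> (1 + (norm x)\<^sup>2) powr p"
      using False pos[of x] bracket[of "x + v" "- v"] by (intro powr_mono2') auto
    then have "(1 + (norm (x + v))\<^sup>2) powr p * (1 + norm v) powr (2 * p) \<le> (1 + (norm x)\<^sup>2) powr p"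
      using pos[of "x + v"] by (simp add: powr_mult v)
    then have "(1 + (norm (x + v))\<^sup>2) powr p * (1 + norm v) powr (2 * p) * (1 + norm v) powr (- (2 * p))
        \<le> (1 + (norm x)\<^sup>2) powr p * (1 + norm v) powr (- (2 * p))"
      by (rule mult_right_mono) auto
    moreover have "(1 + norm v) powr (2 * p) * (1 + norm v) powr (- (2 * p)) = 1"
      unfolding powr_add[symmetric] by (simp add: add_nonneg_eq_0_iff)
    ultimately show ?thesis using False by (simp add: mult.assoc)
  qed
qed

text \<open>For \<open>\<delta> > 0\<close> this is the density in \<open>x\<close> of the normal
  distribution with mean \<open>y\<close> and covariance \<open>\<delta>\<^sup>2\<close> times the
  identity.\<close>

definition gauss_kernel :: "real \<Rightarrow> 'a::euclidean_space \<Rightarrow> 'a \<Rightarrow> real" where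
  "gauss_kernel \<delta> y x = gauss ((1 / \<delta>) *\<^sub>R (x - y)) / (\<delta> ^ DIM('a) * sqrt (2 * pi) ^ DIM('a))"

lemma gauss_kernel_nonneg: "\<delta> > 0 \<Longrightarrow> gauss_kernel \<delta> y x \<ge> 0"
  by (simp add: gauss_kernel_def gauss_nonneg)

lemma gauss_kernel_commute: "gauss_kernel \<delta> y x = gauss_kernel \<delta> x y"
  unfolding gauss_kernel_def by (subst gauss_minus[symmetric]) (simp add: algebra_simps del: gauss_minus)

lemma measurable_gauss_kernel [measurable]:
  assumes [measurable]: "f \<in> borel_measurable M" "g \<in> borel_measurable M"
  shows "(\<lambda>z. gauss_kernel \<delta> (f z) (g z)) \<in> borel_measurable M"
  unfolding gauss_kernel_def by measurable

lemma nn_integral_gauss_kernel: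
  fixes y :: "'a::euclidean_space"
  assumes [measurable]: "f \<in> borel_measurable borel" and \<delta>: "\<delta> > 0"
  shows "(\<integral>\<^sup>+x. f x * ennreal (gauss_kernel \<delta> y x) \<partial>lborel)
       = (\<integral>\<^sup>+u. f (y + \<delta> *\<^sub>R u) * ennreal (gauss u / sqrt (2 * pi) ^ DIM('a)) \<partial>lborel)"
proof -
  have "ennreal (\<delta> ^ DIM('a)) * (f (y + \<delta> *\<^sub>R u) * ennreal (gauss_kernel \<delta> y (y + \<delta> *\<^sub>R u)))
      = f (y + \<delta> *\<^sub>R u) * ennreal (gauss u / sqrt (2 * pi) ^ DIM('a))" for u
  proof -
    have "\<delta> ^ DIM('a) * gauss_kernel \<delta> y (y + \<delta> *\<^sub>R u) = gauss u / sqrt (2 * pi) ^ DIM('a)"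
      using \<delta> by (simp add: gauss_kernel_def)
    then have "ennreal (\<delta> ^ DIM('a)) * ennreal (gauss_kernel \<delta> y (y + \<delta> *\<^sub>R u)) = ennreal (gauss u / sqrt (2 * pi) ^ DIM('a))"
      using \<delta> by (subst ennreal_mult[symmetric]) (auto intro: gauss_kernel_nonneg)
    then show ?thesis by (metis mult.left_commute)
  qed
  then show ?thesis
    using \<delta> by (subst nn_integral_lborel_affine[where c=\<delta> and t=y]) (auto simp: nn_integral_cmult[symmetric])
qed

lemma nn_integral_gauss_kernel_1:
  fixes y :: "'a::euclidean_space"
  assumes \<delta>: "\<delta> > 0"
  shows "(\<integral>\<^sup>+x. ennreal (gauss_kernel \<delta> y x) \<partial>lborel) = 1"
proof -
  have "(\<integral>\<^sup>+x. ennreal (gauss_kernel \<delta> y x) \<partial>lborel)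
      = (\<integral>\<^sup>+u. ennreal (gauss (u::'a) / sqrt (2 * pi) ^ DIM('a)) \<partial>lborel)"
    using nn_integral_gauss_kernel[of "\<lambda>_. 1" \<delta> y] \<delta> by simp
  also have "\<dots> = ennreal (LINT u|lborel. gauss (u::'a) / sqrt (2 * pi) ^ DIM('a))"
    by (intro nn_integral_eq_integral integrable_divide integrable_gauss) (auto simp: gauss_nonneg)
  finally show ?thesis by (simp add: integral_gauss)
qed

text \<open>Jensen's inequality for the probability density \<open>gauss_kernel \<delta> y\<close>,
  obtained from Cauchy-Schwarz by splitting the kernel into two square roots.\<close>

lemma mollification_square_le:
  fixes F :: "'a::euclidean_space \<Rightarrow> complex"
  assumes [measurable]: "F \<in> borel_measurable borel" and \<delta>: "\<delta> > 0"
  shows "ennreal ((norm (LINT x|lborel. of_real (gauss_kernel \<delta> y x) * F x))\<^sup>2)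
       \<le> (\<integral>\<^sup>+x. ennreal ((norm (F x))\<^sup>2) * ennreal (gauss_kernel \<delta> y x) \<partial>lborel)"
proof -
  let ?k = "gauss_kernel \<delta> y"
  have k: "?k x \<ge> 0" for x using gauss_kernel_nonneg[OF \<delta>] .
  have "ennreal (norm (LINT x|lborel. of_real (?k x) * F x)) \<le> (\<integral>\<^sup>+x. ennreal (norm (of_real (?k x) * F x)) \<partial>lborel)"
    \<comment> \<open>Without integrability the Bochner integral has the default value 0 and the
      bound is trivial, so \<open>F\<close> need only be measurable.\<close>
    by (cases "integrable lborel (\<lambda>x. of_real (?k x) * F x)")
       (auto intro: integral_norm_bound_ennreal simp: not_integrable_integral_eq)
  also have "\<dots> = (\<integral>\<^sup>+x. ennreal (norm (F x) * sqrt (?k x)) * ennreal (sqrt (?k x)) \<partial>lborel)"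
    by (intro nn_integral_cong) (simp add: norm_mult k ennreal_mult[symmetric] mult.assoc mult.commute)
  finally have "ennreal (norm (LINT x|lborel. of_real (?k x) * F x)) ^ 2
      \<le> (\<integral>\<^sup>+x. ennreal (norm (F x) * sqrt (?k x)) * ennreal (sqrt (?k x)) \<partial>lborel) ^ 2"
    by (intro power_mono) auto
  also have "\<dots> \<le> (\<integral>\<^sup>+x. ennreal (norm (F x) * sqrt (?k x)) ^ 2 \<partial>lborel) * (\<integral>\<^sup>+x. ennreal (sqrt (?k x)) ^ 2 \<partial>lborel)"
    by (intro Cauchy_Schwarz_nn_integral) measurable
  also have "\<dots> = (\<integral>\<^sup>+x. ennreal ((norm (F x))\<^sup>2) * ennreal (?k x) \<partial>lborel)"
    by (simp add: ennreal_power k power_mult_distrib ennreal_mult nn_integral_gauss_kernel_1[OF \<delta>])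
  finally show ?thesis by (simp add: ennreal_power)
qed

text \<open>After Jensen, Tonelli and the symmetry of the kernel move the mollification from
  \<open>F\<close> to the weight. Peetre's inequality bounds the mollified weight by the weight
  itself times a constant that depends only on \<open>\<delta>\<close>, \<open>p\<close> and the
  dimension.\<close>

lemma weighted_mollification_le:
  fixes F :: "'a::euclidean_space \<Rightarrow> complex"
  assumes [measurable]: "F \<in> borel_measurable borel" and \<delta>: "\<delta> > 0"
  shows "(\<integral>\<^sup>+y. ennreal ((1 + (norm y)\<^sup>2) powr p * (norm (LINT x|lborel. of_real (gauss_kernel \<delta> y x) * F x))\<^sup>2) \<partial>lborel)
       \<le> (\<integral>\<^sup>+u. ennreal ((1 + norm (\<delta> *\<^sub>R u)) powr (2 * \<bar>p\<bar>) * (gauss (u::'a) / sqrt (2 * pi) ^ DIM('a))) \<partial>lborel)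
         * (\<integral>\<^sup>+x. ennreal ((1 + (norm x)\<^sup>2) powr p * (norm (F x))\<^sup>2) \<partial>lborel)" (is "?L \<le> ?c * _")
proof -
  let ?w = "\<lambda>x::'a. (1 + (norm x)\<^sup>2) powr p"
  have "?L \<le> (\<integral>\<^sup>+y. \<integral>\<^sup>+x. ennreal (?w y) * (ennreal ((norm (F x))\<^sup>2) * ennreal (gauss_kernel \<delta> y x)) \<partial>lborel \<partial>lborel)"
  proof (rule nn_integral_mono)
    fix y :: 'a
    have "ennreal (?w y * (norm (LINT x|lborel. of_real (gauss_kernel \<delta> y x) * F x))\<^sup>2)
        \<le> ennreal (?w y) * (\<integral>\<^sup>+x. ennreal ((norm (F x))\<^sup>2) * ennreal (gauss_kernel \<delta> y x) \<partial>lborel)"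
      by (simp add: ennreal_mult mult_left_mono mollification_square_le \<delta>)
    also have "\<dots> = (\<integral>\<^sup>+x. ennreal (?w y) * (ennreal ((norm (F x))\<^sup>2) * ennreal (gauss_kernel \<delta> y x)) \<partial>lborel)"
      by (rule nn_integral_cmult[symmetric]) measurable
    finally show "ennreal (?w y * (norm (LINT x|lborel. of_real (gauss_kernel \<delta> y x) * F x))\<^sup>2) \<le> \<dots>" .
  qed
  also have "\<dots> = (\<integral>\<^sup>+x. \<integral>\<^sup>+y. ennreal (?w y) * (ennreal ((norm (F x))\<^sup>2) * ennreal (gauss_kernel \<delta> y x)) \<partial>lborel \<partial>lborel)"
    by (rule lborel_pair.Fubini') measurable
  also have "\<dots> = (\<integral>\<^sup>+x. ennreal ((norm (F x))\<^sup>2) * (\<integral>\<^sup>+y. ennreal (?w y) * ennreal (gauss_kernel \<delta> x y) \<partial>lborel) \<partial>lborel)"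
    by (subst nn_integral_cmult[symmetric]) (auto simp: gauss_kernel_commute mult_ac)
  also have "\<dots> \<le> (\<integral>\<^sup>+x. ?c * ennreal (?w x * (norm (F x))\<^sup>2) \<partial>lborel)"
  proof (rule nn_integral_mono)
    fix x :: 'a
    have "(\<integral>\<^sup>+y. ennreal (?w y) * ennreal (gauss_kernel \<delta> x y) \<partial>lborel)
        = (\<integral>\<^sup>+u. ennreal (?w (x + \<delta> *\<^sub>R u)) * ennreal (gauss u / sqrt (2 * pi) ^ DIM('a)) \<partial>lborel)"
      by (rule nn_integral_gauss_kernel[OF _ \<delta>]) measurable
    also have "\<dots> \<le> (\<integral>\<^sup>+u. ennreal (?w x) * ennreal ((1 + norm (\<delta> *\<^sub>R u)) powr (2 * \<bar>p\<bar>) * (gauss (u::'a) / sqrt (2 * pi) ^ DIM('a))) \<partial>lborel)"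
    proof (rule nn_integral_mono)
      fix u :: 'a
      have "?w (x + \<delta> *\<^sub>R u) * (gauss u / sqrt (2 * pi) ^ DIM('a))
          \<le> ?w x * (1 + norm (\<delta> *\<^sub>R u)) powr (2 * \<bar>p\<bar>) * (gauss u / sqrt (2 * pi) ^ DIM('a))"
        by (intro mult_right_mono powr_japanese_bracket_shift) (simp add: gauss_nonneg)
      then show "ennreal (?w (x + \<delta> *\<^sub>R u)) * ennreal (gauss u / sqrt (2 * pi) ^ DIM('a))
          \<le> ennreal (?w x) * ennreal ((1 + norm (\<delta> *\<^sub>R u)) powr (2 * \<bar>p\<bar>) * (gauss u / sqrt (2 * pi) ^ DIM('a)))"
        by (subst (1 2) ennreal_mult[symmetric]) (auto simp: gauss_nonneg mult.assoc intro!: ennreal_leI)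
    qed
    also have "\<dots> = ennreal (?w x) * ?c"
      by (rule nn_integral_cmult) measurable
    finally have "ennreal ((norm (F x))\<^sup>2) * (\<integral>\<^sup>+y. ennreal (?w y) * ennreal (gauss_kernel \<delta> x y) \<partial>lborel)
        \<le> ennreal ((norm (F x))\<^sup>2) * (ennreal (?w x) * ?c)"
      by (rule mult_left_mono) simp
    also have "\<dots> = ?c * ennreal (?w x * (norm (F x))\<^sup>2)"
      by (simp add: ennreal_mult mult_ac)
    finally show "ennreal ((norm (F x))\<^sup>2) * (\<integral>\<^sup>+y. ennreal (?w y) * ennreal (gauss_kernel \<delta> x y) \<partial>lborel) \<le> \<dots>" .
  qed
  also have "\<dots> = ?c * (\<integral>\<^sup>+x. ennreal (?w x * (norm (F x))\<^sup>2) \<partial>lborel)"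
    by (rule nn_integral_cmult) measurable
  finally show ?thesis .
qed

text \<open>With \<open>q = 2 * \<bar>p\<bar>\<close> these integrals are the constants of
  \<open>weighted_mollification_le\<close>. The limit being exactly 1 makes the later comparison of
  norms lossless.\<close>

lemma mollification_weight_tendsto_1:
  assumes \<delta>: "\<delta> \<longlonglongrightarrow> 0" "\<And>k. 0 < \<delta> k" "\<And>k. \<delta> k \<le> 1"
  shows "(\<lambda>k. \<integral>\<^sup>+u. ennreal ((1 + norm (\<delta> k *\<^sub>R u)) powr q * (gauss (u::'a::euclidean_space) / sqrt (2 * pi) ^ DIM('a))) \<partial>lborel) \<longlonglongrightarrow> 1"
proof -
  \<comment> \<open>Rounding \<open>q\<close> up gives a natural power for the dominating function,
    to which \<open>integrable_power_gauss\<close> applies; \<open>\<delta> k \<le> 1\<close> makes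
    it independent of \<open>k\<close>.\<close>
  define m where "m = nat \<lceil>q\<rceil>"
  let ?g = "\<lambda>u::'a. gauss u / sqrt (2 * pi) ^ DIM('a)"
  let ?W = "\<lambda>u::'a. (1 + norm u) ^ m * ?g u"
  have le: "(1 + norm (\<delta> k *\<^sub>R u)) powr q \<le> (1 + norm u) ^ m" for k and u :: 'a
  proof -
    have "(1 + norm (\<delta> k *\<^sub>R u)) powr q \<le> (1 + norm (\<delta> k *\<^sub>R u)) powr (real m)"
      by (intro powr_mono) (auto simp: m_def real_nat_ceiling_ge)
    also have "\<dots> = (1 + norm (\<delta> k *\<^sub>R u)) ^ m"
      by (intro powr_realpow) (simp add: add_pos_nonneg)
    also have "\<dots> \<le> (1 + norm u) ^ m"
      using \<delta>(2,3)[of k] by (intro power_mono) (auto intro: mult_left_le_one_le)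
    finally show ?thesis .
  qed
  have W: "integrable lborel ?W"
    using integrable_divide[OF integrable_power_gauss[of m], of "sqrt (2 * pi) ^ DIM('a)"] by simp
  have "(\<lambda>k. \<integral>\<^sup>+u. ennreal ((1 + norm (\<delta> k *\<^sub>R u)) powr q * ?g u) \<partial>lborel) \<longlonglongrightarrow> (\<integral>\<^sup>+u. ennreal (?g u) \<partial>lborel)"
  proof (rule nn_integral_dominated_convergence[where w="\<lambda>u. ennreal (?W u)"])
    show "(\<integral>\<^sup>+u. ennreal (?W u) \<partial>lborel) < \<infinity>"
      using W by (subst nn_integral_eq_integral) (auto simp: gauss_nonneg)
    show "AE u in lborel. ennreal ((1 + norm (\<delta> k *\<^sub>R u)) powr q * ?g u) \<le> ennreal (?W u)" for k
      by (intro AE_I2 ennreal_leI mult_right_mono le) (simp add: gauss_nonneg)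
    have "(\<lambda>k. (1 + norm (\<delta> k *\<^sub>R u)) powr q * ?g u) \<longlonglongrightarrow> (1 + norm (0 *\<^sub>R u)) powr q * ?g u" for u
      by (intro tendsto_intros \<delta>) simp
    then show "AE u in lborel. (\<lambda>k. ennreal ((1 + norm (\<delta> k *\<^sub>R u)) powr q * ?g u)) \<longlonglongrightarrow> ennreal (?g u)"
      by (intro AE_I2 tendsto_ennrealI) simp
  qed measurable
  also have "(\<integral>\<^sup>+u. ennreal (?g u) \<partial>lborel) = 1"
    using nn_integral_gauss_kernel_1[of 1 "0::'a"] by (simp add: gauss_kernel_def)
  finally show ?thesis .
qed

text \<open>Testing only against translated Gaussians suffices: the mollifications of \<open>F\<close> and \<open>h\<close> agree,
  those of \<open>h\<close> converge pointwise, and those of \<open>F\<close> are controlled in the weighted space.\<close>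

lemma weighted_L2_le_of_gauss_tests:
  fixes h F :: "'a::euclidean_space \<Rightarrow> complex"
  assumes h: "continuous_on UNIV h" and M: "\<And>x. norm (h x) \<le> M"
    and F [measurable]: "F \<in> borel_measurable borel"
    and eq: "\<And>y \<delta>. \<delta> > 0 \<Longrightarrow> (LINT x|lborel. of_real (gauss_kernel \<delta> y x) * F x)
        = (LINT x|lborel. of_real (gauss_kernel \<delta> y x) * h x)"
  shows "(\<integral>\<^sup>+x. ennreal ((1 + (norm x)\<^sup>2) powr p * (norm (h x))\<^sup>2) \<partial>lborel)
       \<le> (\<integral>\<^sup>+x. ennreal ((1 + (norm x)\<^sup>2) powr p * (norm (F x))\<^sup>2) \<partial>lborel)"
proof -
  define \<delta> :: "nat \<Rightarrow> real" where "\<delta> k = inverse (real (Suc k))" for k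
  have \<delta>: "\<delta> k > 0" "\<delta> k \<le> 1" for k by (simp_all add: \<delta>_def inverse_eq_divide)
  have \<delta>0: "\<delta> \<longlonglongrightarrow> 0" unfolding \<delta>_def by (rule LIMSEQ_inverse_real_of_nat)
  have hm [measurable]: "h \<in> borel_measurable borel" using h by (rule borel_measurable_continuous_onI)
  let ?w = "\<lambda>x::'a. (1 + (norm x)\<^sup>2) powr p"
  let ?Z = "sqrt (2 * pi) ^ DIM('a)"
  let ?I = "\<integral>\<^sup>+x. ennreal (?w x * (norm (F x))\<^sup>2) \<partial>lborel"
  define H where "H k y = (LINT x|lborel. of_real (gauss_kernel (\<delta> k) y x) * F x)" for k y
  define c where "c k = (\<integral>\<^sup>+u. ennreal ((1 + norm (\<delta> k *\<^sub>R u)) powr (2 * \<bar>p\<bar>) * (gauss (u::'a) / ?Z)) \<partial>lborel)" for k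
  have [measurable]: "H k \<in> borel_measurable borel" for k
    unfolding H_def by measurable
  have "(\<lambda>k. H k y) \<longlonglongrightarrow> h y" for y
  proof -
    have "H k y = (1 / ?Z) *\<^sub>R (LINT u|lborel. gauss u *\<^sub>R h (y + \<delta> k *\<^sub>R u))" for k
    proof -
      have "H k y = (LINT x|lborel. (1 / (\<delta> k ^ DIM('a) * ?Z)) *\<^sub>R (gauss ((1 / \<delta> k) *\<^sub>R (x - y)) *\<^sub>R h x))"
        unfolding H_def eq[OF \<delta>(1)] by (simp add: gauss_kernel_def scaleR_conv_of_real)
      also have "\<dots> = (1 / (\<delta> k ^ DIM('a) * ?Z)) *\<^sub>R (\<delta> k ^ DIM('a) *\<^sub>R (LINT u|lborel. gauss u *\<^sub>R h (y + \<delta> k *\<^sub>R u)))"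
        by (subst integral_scaleR_right) (simp add: integral_gauss_kernel[OF hm M \<delta>(1)])
      finally show ?thesis using \<delta>(1)[of k] by simp
    qed
    moreover have "(\<lambda>k. (1 / ?Z) *\<^sub>R (LINT u|lborel. gauss u *\<^sub>R h (y + \<delta> k *\<^sub>R u))) \<longlonglongrightarrow> (1 / ?Z) *\<^sub>R (?Z *\<^sub>R h y)"
      by (intro tendsto_scaleR tendsto_const gauss_mollification_tendsto[OF h M \<delta>0])
    ultimately show ?thesis by simp
  qed
  then have "(\<lambda>k. ennreal (?w y * (norm (H k y))\<^sup>2)) \<longlonglongrightarrow> ennreal (?w y * (norm (h y))\<^sup>2)" for y
    by (intro tendsto_ennrealI tendsto_intros)
  then have "ennreal (?w y * (norm (h y))\<^sup>2) = liminf (\<lambda>k. ennreal (?w y * (norm (H k y))\<^sup>2))" for y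
    by (metis lim_imp_Liminf sequentially_bot)
  then have "(\<integral>\<^sup>+y. ennreal (?w y * (norm (h y))\<^sup>2) \<partial>lborel)
      = (\<integral>\<^sup>+y. liminf (\<lambda>k. ennreal (?w y * (norm (H k y))\<^sup>2)) \<partial>lborel)"
    by simp
  also have "\<dots> \<le> liminf (\<lambda>k. \<integral>\<^sup>+y. ennreal (?w y * (norm (H k y))\<^sup>2) \<partial>lborel)"
    by (rule nn_integral_liminf) measurable
  also have "\<dots> \<le> liminf (\<lambda>k. c k * ?I)"
    unfolding H_def c_def by (intro Liminf_mono always_eventually allI weighted_mollification_le F \<delta>)
  also have "\<dots> \<le> ?I"
  \<comment> \<open>For infinite \<open>?I\<close> nothing is to be shown; for finite
    \<open>?I\<close> the limit of \<open>c\<close> passes through the product.\<close>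
  proof (cases "?I = \<infinity>")
    case False
    have "c \<longlonglongrightarrow> 1"
      unfolding c_def by (intro mollification_weight_tendsto_1 \<delta> \<delta>0)
    then have "(\<lambda>k. c k * ?I) \<longlonglongrightarrow> 1 * ?I"
      using False by (intro tendsto_mult_ennreal tendsto_const) auto
    then have "liminf (\<lambda>k. c k * ?I) = 1 * ?I"
      by (intro lim_imp_Liminf) auto
    then show ?thesis by simp
  qed simp
  finally show ?thesis .
qed

subsection \<open>Bounded multipliers\<close>

text \<open>The seminorms without derivatives suffice: those of weight 0 and \<open>?m\<close> bound
  \<open>(1 + norm x) ^ ?m * norm (\<phi> x)\<close>, and \<open>?d\<close> is integrable. The lemma
  is applied to the image of \<open>g\<close>, which is bounded as the inverse transform of an
  integrable function.\<close>

lemma tempered_distribution_of_bounded: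
  fixes f :: "real^'n::finite \<Rightarrow> complex"
  assumes [measurable]: "f \<in> borel_measurable borel" and M: "\<And>x. norm (f x) \<le> M"
  shows "tempered_distribution (distribution_of f)"
proof -
  let ?m = "2 * DIM(real^'n)"
  let ?d = "\<lambda>x::real^'n. inverse ((1 + norm x) ^ ?m)"
  have M0: "M \<ge> 0" using order_trans[OF norm_ge_zero M[of 0]] .
  have int: "integrable lborel (\<lambda>x. f x * \<phi> x)" if \<phi>: "schwartz \<phi>" for \<phi>
  proof (rule Bochner_Integration.integrable_bound)
    show "integrable lborel (\<lambda>x. M * norm (\<phi> x))"
      by (intro integrable_mult_right integrable_norm schwartz_integrable \<phi>)
    show "(\<lambda>x. f x * \<phi> x) \<in> borel_measurable lborel"
      using schwartz_measurable[OF \<phi>] by measurable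
    show "AE x in lborel. norm (f x * \<phi> x) \<le> norm (M * norm (\<phi> x))"
      using M M0 by (auto simp: norm_mult intro!: mult_right_mono)
  qed
  have bound: "norm (distribution_of f \<phi>) \<le> M * (2 ^ ?m * 2) * (LINT x|lborel. ?d x) * B"
    if \<phi>: "schwartz \<phi>"
      and B: "\<forall>k is x. k \<le> ?m \<longrightarrow> length is \<le> ?m \<longrightarrow> norm x ^ k * norm (partial_derivs is \<phi> x) \<le> B" for \<phi> B
  proof -
    have B': "norm x ^ k * norm (\<phi> x) \<le> B" if "k \<le> ?m" for k x
      using B[rule_format, of k "[]" x] that by (simp add: partial_derivs_def)
    have "norm (f x * \<phi> x) \<le> M * (2 ^ ?m * 2) * B * ?d x" for x
    proof -
      have "(1 + norm x) ^ ?m * norm (\<phi> x) \<le> 2 ^ ?m * (1 + norm x ^ ?m) * norm (\<phi> x)"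
        by (intro mult_right_mono one_plus_power_le) auto
      also have "\<dots> = 2 ^ ?m * (norm x ^ 0 * norm (\<phi> x) + norm x ^ ?m * norm (\<phi> x))"
        by (simp add: algebra_simps)
      also have "\<dots> \<le> 2 ^ ?m * (B + B)"
        by (intro mult_left_mono add_mono B') auto
      finally have le: "(1 + norm x) ^ ?m * norm (\<phi> x) \<le> 2 ^ ?m * 2 * B" by simp
      have "(1 + norm x) ^ ?m > 0" by (intro zero_less_power) (simp add: add_pos_nonneg)
      then have "norm (\<phi> x) \<le> 2 ^ ?m * 2 * B * ?d x"
        using le unfolding divide_inverse[symmetric] by (subst pos_le_divide_eq) (simp_all add: mult.commute)
      then have "norm (f x) * norm (\<phi> x) \<le> M * (2 ^ ?m * 2 * B * ?d x)"
        using M M0 by (intro mult_mono) auto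
      then show ?thesis by (simp only: norm_mult mult.assoc)
    qed
    then have "norm (distribution_of f \<phi>) \<le> (LINT x|lborel. M * (2 ^ ?m * 2) * B * ?d x)"
      unfolding distribution_of_def
      by (intro Bochner_Integration.integral_norm_bound_integral int \<phi> integrable_mult_right integrable_inverse_one_plus_norm)
    also have "\<dots> = M * (2 ^ ?m * 2) * B * (LINT x|lborel. ?d x)"
      by (rule integral_mult_right_zero)
    finally show ?thesis by (simp only: mult_ac)
  qed
  show ?thesis
    unfolding tempered_distribution_def
  proof (intro conjI allI impI)
    fix \<phi> \<psi> :: "real^'n \<Rightarrow> complex" assume "schwartz \<phi>" "schwartz \<psi>"
    then show "distribution_of f (\<lambda>x. \<phi> x + \<psi> x) = distribution_of f \<phi> + distribution_of f \<psi>"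
      by (simp add: distribution_of_def distrib_left int)
  next
    fix c and \<phi> :: "real^'n \<Rightarrow> complex" assume "schwartz \<phi>"
    show "distribution_of f (\<lambda>x. c * \<phi> x) = c * distribution_of f \<phi>"
      unfolding distribution_of_def mult.left_commute[of _ c] by (rule integral_mult_right_zero)
  next
    show "\<exists>K N. \<forall>\<phi> B. schwartz \<phi> \<longrightarrow>
        (\<forall>k is x. k \<le> N \<longrightarrow> length is \<le> N \<longrightarrow> norm x ^ k * norm (partial_derivs is \<phi> x) \<le> B) \<longrightarrow>
        norm (distribution_of f \<phi>) \<le> K * B"
      \<comment> \<open>The witnesses are \<open>N = ?m\<close> and
        \<open>K = M * (2 ^ ?m * 2) * (LINT x|lborel. ?d x)\<close>.\<close>
      using bound by blast
  qed
qed

text \<open>For a Schwartz \<open>\<phi>\<close>, the duality in \<open>sobolev_transform\<close>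
  and the multiplication formula give the integral of \<open>g * fourier \<phi>\<close> two forms,
  one with \<open>F\<close> and one with \<open>fourier g\<close>. Every Gaussian kernel is a
  constant times such a \<open>\<phi>\<close>.\<close>

lemma weighted_L2_fourier_le:
  fixes g F :: "real^'n::finite \<Rightarrow> complex"
  assumes g: "schwartz g" and F: "sobolev_transform s (distribution_of g) F"
  shows "(\<integral>\<^sup>+\<xi>. ennreal ((1 + (norm \<xi>)\<^sup>2) powr s * (norm (fourier g \<xi>))\<^sup>2) \<partial>lborel)
       \<le> (\<integral>\<^sup>+\<xi>. ennreal ((1 + (norm \<xi>)\<^sup>2) powr s * (norm (F \<xi>))\<^sup>2) \<partial>lborel)"
proof (rule weighted_L2_le_of_gauss_tests)
  have gi: "integrable lborel g" by (rule schwartz_integrable[OF g])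
  show "continuous_on UNIV (fourier g)" by (rule continuous_fourier[OF gi])
  show "norm (fourier g x) \<le> (LINT x|lborel. norm (g x))" for x by (rule norm_fourier_le)
  show "F \<in> borel_measurable borel" using F by (simp add: sobolev_transform_def)
  fix y :: "real^'n" and \<delta> :: real assume \<delta>: "\<delta> > 0"
  define \<phi> where "\<phi> x = complex_of_real (exp (- (1 / (2 * \<delta>\<^sup>2) * (norm (x - y))\<^sup>2)))" for x
  have \<phi>: "schwartz \<phi>"
    unfolding \<phi>_def using \<delta> by (intro schwartz_gaussian) simp
  define Z where "Z = complex_of_real (1 / (\<delta> ^ CARD('n) * sqrt (2 * pi) ^ CARD('n)))"
  have k: "of_real (gauss_kernel \<delta> y x) * z = Z * (z * \<phi> x)" for x z
    using \<delta> by (simp add: gauss_kernel_def gauss_def \<phi>_def Z_def power_mult_distrib power_divide)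
  have "(LINT x|lborel. F x * \<phi> x) = distribution_of g (fourier \<phi>)"
    using F \<phi> by (simp add: sobolev_transform_def)
  also have "\<dots> = (LINT x|lborel. fourier g x * \<phi> x)"
    unfolding distribution_of_def by (rule integral_fourier_mult[symmetric, OF gi schwartz_integrable[OF \<phi>]])
  finally show "(LINT x|lborel. of_real (gauss_kernel \<delta> y x) * F x) = (LINT x|lborel. of_real (gauss_kernel \<delta> y x) * fourier g x)"
    by (simp add: k)
qed

text \<open>The transform \<open>F\<close> supplies finiteness: its weighted integral bounds that of
  \<open>\<sigma> * fourier g\<close> in extended nonnegative form. This yields integrability, and
  only then are the real integrals compared.\<close>

lemma
  fixes g F \<sigma> :: "real^'n::finite \<Rightarrow> complex"
  assumes g: "schwartz g" and F: "sobolev_transform s (distribution_of g) F"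
    and \<sigma> [measurable]: "\<sigma> \<in> borel_measurable borel" and C: "\<And>\<xi>. norm (\<sigma> \<xi>) \<le> C"
  shows sobolev_transform_fourier_multiplier:
      "sobolev_transform s (distribution_of (fourier_multiplier \<sigma> g)) (\<lambda>\<xi>. \<sigma> \<xi> * fourier g \<xi>)"
    and weighted_L2_fourier_multiplier_le:
      "(LINT \<xi>|lborel. (1 + (norm \<xi>)\<^sup>2) powr s * (norm (\<sigma> \<xi> * fourier g \<xi>))\<^sup>2)
       \<le> C\<^sup>2 * (LINT \<xi>|lborel. (1 + (norm \<xi>)\<^sup>2) powr s * (norm (F \<xi>))\<^sup>2)"
proof -
  let ?h = "\<lambda>\<xi>. \<sigma> \<xi> * fourier g \<xi>"
  let ?w = "\<lambda>\<xi>::real^'n. (1 + (norm \<xi>)\<^sup>2) powr s"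
  have gi: "integrable lborel g" by (rule schwartz_integrable[OF g])
  note [measurable] = measurable_fourier[OF gi]
  have C0: "C \<ge> 0" using order_trans[OF norm_ge_zero C[of 0]] .
  have h: "integrable lborel ?h"
  proof (rule Bochner_Integration.integrable_bound)
    show "integrable lborel (\<lambda>\<xi>. C * norm (fourier g \<xi>))"
      by (intro integrable_mult_right integrable_norm schwartz_integrable_fourier g)
    show "AE \<xi> in lborel. norm (?h \<xi>) \<le> norm (C * norm (fourier g \<xi>))"
      using C C0 by (auto simp: norm_mult intro!: mult_right_mono)
  qed measurable
  have Fi: "integrable lborel (\<lambda>\<xi>. ?w \<xi> * (norm (F \<xi>))\<^sup>2)"
    using F by (simp add: sobolev_transform_def)
  have "(\<integral>\<^sup>+\<xi>. ennreal (?w \<xi> * (norm (?h \<xi>))\<^sup>2) \<partial>lborel)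
      \<le> (\<integral>\<^sup>+\<xi>. ennreal (C\<^sup>2) * ennreal (?w \<xi> * (norm (fourier g \<xi>))\<^sup>2) \<partial>lborel)"
  proof (rule nn_integral_mono)
    fix \<xi> :: "real^'n"
    have "(norm (?h \<xi>))\<^sup>2 \<le> C\<^sup>2 * (norm (fourier g \<xi>))\<^sup>2"
      unfolding norm_mult power_mult_distrib by (intro mult_right_mono power_mono C) auto
    then have "?w \<xi> * (norm (?h \<xi>))\<^sup>2 \<le> C\<^sup>2 * (?w \<xi> * (norm (fourier g \<xi>))\<^sup>2)"
      by (subst mult.left_commute) (intro mult_left_mono, auto)
    then show "ennreal (?w \<xi> * (norm (?h \<xi>))\<^sup>2) \<le> ennreal (C\<^sup>2) * ennreal (?w \<xi> * (norm (fourier g \<xi>))\<^sup>2)"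
      by (subst ennreal_mult[symmetric]) (auto intro: ennreal_leI)
  qed
  also have "\<dots> = ennreal (C\<^sup>2) * (\<integral>\<^sup>+\<xi>. ennreal (?w \<xi> * (norm (fourier g \<xi>))\<^sup>2) \<partial>lborel)"
    by (rule nn_integral_cmult) measurable
  also have "\<dots> \<le> ennreal (C\<^sup>2) * (\<integral>\<^sup>+\<xi>. ennreal (?w \<xi> * (norm (F \<xi>))\<^sup>2) \<partial>lborel)"
    by (intro mult_left_mono weighted_L2_fourier_le[OF g F]) auto
  also have "(\<integral>\<^sup>+\<xi>. ennreal (?w \<xi> * (norm (F \<xi>))\<^sup>2) \<partial>lborel) = ennreal (LINT \<xi>|lborel. ?w \<xi> * (norm (F \<xi>))\<^sup>2)"
    by (rule nn_integral_eq_integral[OF Fi]) auto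
  also have "ennreal (C\<^sup>2) * \<dots> = ennreal (C\<^sup>2 * (LINT \<xi>|lborel. ?w \<xi> * (norm (F \<xi>))\<^sup>2))"
    by (rule ennreal_mult[symmetric]) (auto intro!: integral_nonneg_AE)
  finally have le: "(\<integral>\<^sup>+\<xi>. ennreal (?w \<xi> * (norm (?h \<xi>))\<^sup>2) \<partial>lborel) \<le> \<dots>" .
  have hi: "integrable lborel (\<lambda>\<xi>. ?w \<xi> * (norm (?h \<xi>))\<^sup>2)"
  proof (rule integrableI_bounded)
    show "(\<integral>\<^sup>+\<xi>. ennreal (norm (?w \<xi> * (norm (?h \<xi>))\<^sup>2)) \<partial>lborel) < \<infinity>"
      using le_less_trans[OF le ennreal_less_top] by simp
  qed measurable
  show "(LINT \<xi>|lborel. ?w \<xi> * (norm (?h \<xi>))\<^sup>2) \<le> C\<^sup>2 * (LINT \<xi>|lborel. ?w \<xi> * (norm (F \<xi>))\<^sup>2)"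
    using le by (subst (asm) nn_integral_eq_integral[OF hi])
      (auto simp: ennreal_le_iff integral_nonneg_AE)
  show "sobolev_transform s (distribution_of (fourier_multiplier \<sigma> g)) ?h"
    unfolding sobolev_transform_def
  proof (intro conjI allI impI)
    show "tempered_distribution (distribution_of (fourier_multiplier \<sigma> g))"
      unfolding fourier_multiplier_def
      by (rule tempered_distribution_of_bounded[OF measurable_inverse_fourier[OF h] norm_inverse_fourier_le])
    show "integrable lborel (\<lambda>\<xi>. ?w \<xi> * (norm (?h \<xi>))\<^sup>2)" by (rule hi)
    fix \<phi> :: "real^'n \<Rightarrow> complex" assume \<phi>: "schwartz \<phi>"
    \<comment> \<open>The inverse transform is moved onto \<open>fourier \<phi>\<close>, where
      inversion returns \<open>\<phi>\<close>.\<close>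
    have "distribution_of (fourier_multiplier \<sigma> g) (fourier \<phi>) = (LINT x|lborel. ?h x * inverse_fourier (fourier \<phi>) x)"
      unfolding distribution_of_def fourier_multiplier_def
      by (intro integral_inverse_fourier_mult h schwartz_integrable_fourier \<phi>)
    then show "distribution_of (fourier_multiplier \<sigma> g) (fourier \<phi>) = (LINT x|lborel. ?h x * \<phi> x)"
      by (simp add: schwartz_inverse_fourier_fourier \<phi>)
  qed measurable
qed

theorem sobolev_norm_fourier_multiplier_le:
  fixes g \<sigma> :: "real^'n::finite \<Rightarrow> complex"
  assumes g: "schwartz g" and \<sigma>: "\<sigma> \<in> borel_measurable borel" and C: "\<And>\<xi>. norm (\<sigma> \<xi>) \<le> C" "C > 0"
  shows "sobolev_norm s (distribution_of (fourier_multiplier \<sigma> g)) \<le> ennreal C * sobolev_norm s (distribution_of g)"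
proof -
  let ?L = "sobolev_norm s (distribution_of (fourier_multiplier \<sigma> g))"
  have CC: "ennreal (1 / C) * (ennreal C * z) = z" "ennreal C * (ennreal (1 / C) * z) = z" for z
    using C(2) by (simp_all add: mult.assoc[symmetric] ennreal_mult[symmetric])
  \<comment> \<open>Dividing by \<open>C\<close> leaves a bare infimum on the right, so it is enough
    to treat each \<open>F\<close> separately. An empty family is covered too, its infimum being
    \<open>\<infinity>\<close>.\<close>
  have "ennreal (1 / C) * ?L \<le> sobolev_norm s (distribution_of g)"
    unfolding sobolev_norm_def[of s "distribution_of g"]
  proof (rule INF_greatest)
    fix F assume "F \<in> {F. sobolev_transform s (distribution_of g) F}"
    then have F: "sobolev_transform s (distribution_of g) F" by simp
    let ?N = "\<lambda>F::real^'n \<Rightarrow> complex. LINT \<xi>|lborel. (1 + (norm \<xi>)\<^sup>2) powr s * (norm (F \<xi>))\<^sup>2"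
    have "?L \<le> ennreal (sqrt (?N (\<lambda>\<xi>. \<sigma> \<xi> * fourier g \<xi>)))"
      unfolding sobolev_norm_def
      by (rule INF_lower) (simp add: sobolev_transform_fourier_multiplier[OF g F \<sigma> C(1)])
    also have "\<dots> \<le> ennreal (sqrt (C\<^sup>2 * ?N F))"
      by (intro ennreal_leI real_sqrt_le_mono weighted_L2_fourier_multiplier_le[OF g F \<sigma> C(1)])
    also have "\<dots> = ennreal C * ennreal (sqrt (?N F))"
      using C(2) by (simp add: real_sqrt_mult ennreal_mult integral_nonneg_AE)
    finally have "ennreal (1 / C) * ?L \<le> ennreal (1 / C) * \<dots>"
      by (rule mult_left_mono) simp
    then show "ennreal (1 / C) * ?L \<le> ennreal (sqrt (?N F))"
      unfolding CC .
  qed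
  then have "ennreal C * (ennreal (1 / C) * ?L) \<le> ennreal C * sobolev_norm s (distribution_of g)"
    by (rule mult_left_mono) simp
  then show ?thesis unfolding CC .
qed

subsection \<open>The symbol\<close>

text \<open>With \<open>a\<close> and \<open>q\<close> as in the proof, the symbol for nonzero
  \<open>\<xi>\<close> is \<open>exp (- (a * \<tau>)) * sin (a * q * \<tau>) / (a * q)\<close>. The
  formula needs no case distinction: at \<open>\<xi> = 0\<close> the symbol is
  \<open>\<tau>\<close>, and the right-hand side equals 1.\<close>

lemma deriv_symbol_S:
  fixes \<xi> :: "real^'n::finite"
  shows "deriv (\<lambda>\<tau>. symbol_S \<xi> \<tau>) t =
    exp (- ((norm \<xi>)\<^sup>2 * t / (2 * (1 + (norm \<xi>)\<^sup>2)))) *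
    (cos ((norm \<xi>)\<^sup>2 * sqrt (3 + 4 * (norm \<xi>)\<^sup>2) * t / (2 * (1 + (norm \<xi>)\<^sup>2)))
     - sin ((norm \<xi>)\<^sup>2 * sqrt (3 + 4 * (norm \<xi>)\<^sup>2) * t / (2 * (1 + (norm \<xi>)\<^sup>2))) / sqrt (3 + 4 * (norm \<xi>)\<^sup>2))"
proof (cases "\<xi> = 0")
  case True
  then have "(\<lambda>\<tau>. symbol_S \<xi> \<tau>) = (\<lambda>\<tau>. \<tau>)" by (simp add: symbol_S_def)
  with True show ?thesis by simp
next
  case False
  define q where "q = sqrt (3 + 4 * (norm \<xi>)\<^sup>2)"
  define a where "a = (norm \<xi>)\<^sup>2 / (2 * (1 + (norm \<xi>)\<^sup>2))"
  have q: "q > 0" by (simp add: q_def add_pos_nonneg)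
  have a: "a > 0" using False by (simp add: a_def add_pos_nonneg)
  have e: "(norm \<xi>)\<^sup>2 * \<tau> / (2 * (1 + (norm \<xi>)\<^sup>2)) = a * \<tau>"
    "(norm \<xi>)\<^sup>2 * q * \<tau> / (2 * (1 + (norm \<xi>)\<^sup>2)) = a * q * \<tau>" for \<tau>
    by (simp_all add: a_def)
  have b: "2 * (1 + (norm \<xi>)\<^sup>2) / ((norm \<xi>)\<^sup>2 * q) = 1 / (a * q)"
    by (simp add: a_def)
  have "((\<lambda>\<tau>. exp (- (a * \<tau>)) * (1 / (a * q)) * sin (a * q * \<tau>)) has_field_derivative
      exp (- (a * t)) * (cos (a * q * t) - sin (a * q * t) / q)) (at t)"
    using a q by (auto intro!: derivative_eq_intros simp: field_simps)
  then show ?thesis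
    using False unfolding symbol_S_def q_def[symmetric] e b by (simp add: DERIV_imp_deriv)
qed

text \<open>The 2 is 1 for the cosine plus 1 for the sine divided by \<open>q \<ge> 1\<close>;
  positivity of \<open>t\<close> keeps the damping factor at most 1.\<close>

lemma abs_deriv_symbol_S_le:
  fixes \<xi> :: "real^'n::finite"
  assumes "t > 0"
  shows "\<bar>deriv (\<lambda>\<tau>. symbol_S \<xi> \<tau>) t\<bar> \<le> 2"
proof -
  define q where "q = sqrt (3 + 4 * (norm \<xi>)\<^sup>2)"
  define b where "b = (norm \<xi>)\<^sup>2 * q * t / (2 * (1 + (norm \<xi>)\<^sup>2))"
  have "sqrt 1 \<le> q" unfolding q_def by (intro real_sqrt_le_mono) simp
  then have q: "q \<ge> 1" by simp
  have "\<bar>sin b / q\<bar> \<le> 1"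
    using q order_trans[OF abs_sin_le_one[of b] q] by (simp add: abs_divide divide_le_eq_1)
  then have "\<bar>cos b - sin b / q\<bar> \<le> 2"
    using abs_cos_le_one[of b] by linarith
  moreover have "exp (- ((norm \<xi>)\<^sup>2 * t / (2 * (1 + (norm \<xi>)\<^sup>2)))) \<le> 1"
    using assms by (simp add: add_nonneg_pos)
  ultimately have "exp (- ((norm \<xi>)\<^sup>2 * t / (2 * (1 + (norm \<xi>)\<^sup>2)))) * \<bar>cos b - sin b / q\<bar> \<le> 1 * 2"
    by (intro mult_mono) auto
  then show ?thesis
    unfolding deriv_symbol_S q_def[symmetric] b_def[symmetric] by (simp add: abs_mult)
qed

text \<open>Low frequencies are bounded by 1 and high ones by the square of the norm, since the
  exponent \<open>2 * \<theta>\<close> lies between 0 and 2.\<close>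

lemma symbol_laplacian_power_le:
  assumes "0 \<le> \<theta>" "\<theta> \<le> 1"
  shows "0 \<le> symbol_laplacian_power \<theta> \<xi>" "symbol_laplacian_power \<theta> \<xi> \<le> 1 + (norm \<xi>)\<^sup>2"
proof -
  show "0 \<le> symbol_laplacian_power \<theta> \<xi>" by (simp add: symbol_laplacian_power_def)
  have "norm \<xi> powr (2 * \<theta>) \<le> 1 + (norm \<xi>)\<^sup>2"
  proof (cases "norm \<xi> \<le> 1")
    case True
    then have "norm \<xi> powr (2 * \<theta>) \<le> 1" using assms by (intro powr_le1) auto
    then show ?thesis by (simp add: add_increasing2)
  next
    case False
    then have "norm \<xi> powr (2 * \<theta>) \<le> norm \<xi> powr 2" using assms by (intro powr_mono) auto
    then show ?thesis using False by simp
  qed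
  then show "symbol_laplacian_power \<theta> \<xi> \<le> 1 + (norm \<xi>)\<^sup>2"
    by (simp add: symbol_laplacian_power_def)
qed

theorem corollary3p9:
  "\<exists>C::real. C > 0 \<and>
     (\<forall>\<theta> s t :: real. \<forall>g :: real^'n::finite \<Rightarrow> complex.
        0 \<le> \<theta> \<longrightarrow> \<theta> \<le> 1 \<longrightarrow> t > 0 \<longrightarrow> schwartz g \<longrightarrow>
        sobolev_norm (s - 1) (distribution_of (dt_Lambda \<theta> t g))
          \<le> ennreal C * sobolev_norm (s - 1) (distribution_of g))"
\<comment> \<open>The witness is the bound on the time derivative; the remaining factor of the
  symbol lies between 0 and 1.\<close>
proof (intro exI[of _ 2] conjI allI impI)
  fix \<theta> s t :: real and g :: "real^'n \<Rightarrow> complex"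
  assume \<theta>: "0 \<le> \<theta>" "\<theta> \<le> 1" and t: "t > 0" and g: "schwartz g"
  show "sobolev_norm (s - 1) (distribution_of (dt_Lambda \<theta> t g))
      \<le> ennreal 2 * sobolev_norm (s - 1) (distribution_of g)"
    unfolding dt_Lambda_def
  proof (rule sobolev_norm_fourier_multiplier_le[OF g])
    show "(\<lambda>\<xi>::real^'n. complex_of_real (deriv (\<lambda>\<tau>. symbol_S \<xi> \<tau>) t * inverse (1 + (norm \<xi>)\<^sup>2) *
        symbol_laplacian_power \<theta> \<xi>)) \<in> borel_measurable borel"
      \<comment> \<open>Measurability in \<open>\<xi>\<close> is read off the closed formula, as
        \<open>deriv\<close> itself offers no handle on it.\<close>
      unfolding deriv_symbol_S symbol_laplacian_power_def by measurable
    show "norm (complex_of_real (deriv (\<lambda>\<tau>. symbol_S \<xi> \<tau>) t * inverse (1 + (norm \<xi>)\<^sup>2) *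
        symbol_laplacian_power \<theta> \<xi>)) \<le> 2" for \<xi> :: "real^'n"
    proof -
      have pos: "1 + (norm \<xi>)\<^sup>2 > 0" by (simp add: add_pos_nonneg)
      then have "0 \<le> inverse (1 + (norm \<xi>)\<^sup>2) * symbol_laplacian_power \<theta> \<xi>"
        "inverse (1 + (norm \<xi>)\<^sup>2) * symbol_laplacian_power \<theta> \<xi> \<le> 1"
        using symbol_laplacian_power_le[OF \<theta>, of \<xi>] by (simp_all add: field_simps)
      then have "\<bar>deriv (\<lambda>\<tau>. symbol_S \<xi> \<tau>) t\<bar> * \<bar>inverse (1 + (norm \<xi>)\<^sup>2) * symbol_laplacian_power \<theta> \<xi>\<bar> \<le> 2 * 1"
        by (intro mult_mono abs_deriv_symbol_S_le t) auto
      then show ?thesis unfolding norm_of_real abs_mult mult.assoc by simp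
    qed
  qed simp
qed simp

end
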